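(* Let $v\ge 5$ be an odd integer such that $v\neq 9$ and $v\neq 24c+57$ for every integer $c\ge 2$. Then there exists a three-fold triple system $TS_3(v)$ that is simultaneously cyclic, simple, and indecomposable.
   Context: A $\lambda$-fold triple system of order $v$, denoted $TS_\lambda(v)$, is a pair $(V,\mathcal{B})$ where $V$ is a set of $v$ points and $\mathcal{B}$ is a collection (multiset) of $3$-subsets of $V$ (blocks) such that every $2$-subset of $V$ is contained in exactly $\lambda$ blocks, counted with multiplicity. An automorphism of $(V,\mathcal{B})$ is a permutation of $V$ leaving $\mathcal{B}$ invariant. A $TS_\lambda(v)$ is cyclic if its automorphism group contains a $v$-cycle (a permutation of $V$ consisting of a single cycle of length $v$). It is simple if it contains no repeated blocks. It is indecomposable if $\mathcal{B}$ cannot be partitioned into $\mathcal{B}_1,\mathcal{B}_2$ such that $(V,\mathcal{B}_1)$ is a $TS_{\lambda_1}(v)$ and $(V,\mathcal{B}_2)$ is a $TS_{\lambda_2}(v)$ with $\lambda_1+\lambda_2=\lambda$ and $\lambda_1,\lambda_2\ge 1$. *)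

theory Defs
  imports "HOL-Library.Multiset" "HOL-Combinatorics.Permutations" "HOL-Combinatorics.Orbits"
begin

definition triple_system :: "nat \<Rightarrow> nat \<Rightarrow> 'a set \<Rightarrow> 'a set multiset \<Rightarrow> bool" where
  "triple_system l v V B \<longleftrightarrow>
     finite V \<and> card V = v \<and>
     (\<forall>b \<in># B. b \<subseteq> V \<and> card b = 3) \<and>
     (\<forall>e. e \<subseteq> V \<and> card e = 2 \<longrightarrow> size {#b \<in># B. e \<subseteq> b#} = l)"

definition automorphisms :: "'a set \<Rightarrow> 'a set multiset \<Rightarrow> ('a \<Rightarrow> 'a) set" where
  "automorphisms V B = {p. p permutes V \<and> image_mset (\<lambda>b. p ` b) B = B}"

(* Among permutations of V, those with cyclic_on p V are exactly the
   (card V)-cycles: V is a single orbit of p. *)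
definition cyclic_system :: "'a set \<Rightarrow> 'a set multiset \<Rightarrow> bool" where
  "cyclic_system V B \<longleftrightarrow> (\<exists>p \<in> automorphisms V B. cyclic_on p V)"

definition simple_system :: "'a set multiset \<Rightarrow> bool" where
  "simple_system B \<longleftrightarrow> (\<forall>b. count B b \<le> 1)"

definition decomposable_system :: "nat \<Rightarrow> nat \<Rightarrow> 'a set \<Rightarrow> 'a set multiset \<Rightarrow> bool" where
  "decomposable_system l v V B \<longleftrightarrow>
     (\<exists>l1 l2 B1 B2. l1 \<ge> 1 \<and> l2 \<ge> 1 \<and> l1 + l2 = l \<and> B1 + B2 = B \<and>
        triple_system l1 v V B1 \<and> triple_system l2 v V B2)"

abbreviation indecomposable_system :: "nat \<Rightarrow> nat \<Rightarrow> 'a set \<Rightarrow> 'a set multiset \<Rightarrow> bool" where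
  "indecomposable_system l v V B \<equiv> \<not> decomposable_system l v V B"

end

theory Submission
  imports Defs "HOL-Number_Theory.Cong"
begin

text \<open>The points are the residues modulo \<open>v\<close> with the translation \<open>x \<mapsto> x + 1\<close> as the \<open>v\<close>-cycle. The three-term
arithmetic progressions \<open>{x, x + i, x + 2 * i}\<close>, with \<open>i\<close> up to sign, cover every pair three times:
a pair is the first, the last or the outer pair of a progression. If 3 does not divide the odd number
\<open>v\<close>, then all these progressions are distinct. The system is then indecomposable: a $TS_1$ consisting of progressions has
\<open>n e\<close> blocks of step \<open>e\<close> with \<open>2 * n (2 * e) + n e = v\<close>, which forces \<open>n e = v / 3\<close>,
and this is not an integer (\<open>ap_no_splitting\<close>).

If 3 divides \<open>v\<close>, then the progression of step \<open>m = v / 3\<close> would be repeated. The following two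
systems avoid this.

For \<open>v = 3 * u\<close> with \<open>u \<ge> 5\<close> coprime to 3 the progressions of three suitable steps, among them \<open>m\<close>, are
exchanged for three orbits of triples that are transversal to the residue classes modulo 3
(\<open>switched_kernel\<close>). Inside the class of 0 only progressions remain, so a $TS_1$ in this system would
induce one in the system of progressions modulo \<open>u\<close>, which does not exist
(\<open>switched_no_splitting\<close>).

For \<open>v = 27\<close> an explicit system is indecomposable for local reasons (\<open>kernel27\<close>, \<open>no_splitting27\<close>).

Finally, a system on \<open>w\<close> points with 3 dividing \<open>w\<close> can be placed on the subgroup of order \<open>w\<close> of the
integers modulo \<open>k * w\<close>, \<open>k\<close> odd, and completed by progressions for all differences outside the
subgroup (\<open>lift_kernel\<close>). A $TS_1$ in the large system restricts to the subgroup
(\<open>lift_splitting\<close>). This covers \<open>v = 9 * u\<close> and all odd multiples of 27.\<close>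

section \<open>Cyclic triple systems from translation-invariant families\<close>

text \<open>A translation-invariant family of triples of $\mathbb{Z}_v$, described on integer representatives:
\<open>R d f\<close> says that \<open>{x, x + d, x + f}\<close> is a triple of the family for every \<open>x\<close>. The rules
\<open>swap\<close> and \<open>rebase\<close> state that the family does not depend on the order in which the points of a
triple are listed, since \<open>{x, x + d, x + f}\<close> read from \<open>x + d\<close> has differences \<open>- d\<close> and \<open>f - d\<close>.
The last two rules say that the three points are distinct.\<close>
locale cyclic_triples =
  fixes v :: int and R :: "int \<Rightarrow> int \<Rightarrow> bool"
  assumes pos: "v > 0"
    and periodic: "R (d mod v) (f mod v) = R d f"
    and swap: "R d f \<Longrightarrow> R f d"
    and rebase: "R d f \<Longrightarrow> R (- d) (f - d)"
    and nonzero: "R d f \<Longrightarrow> d mod v \<noteq> 0"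
    and distinct: "R d f \<Longrightarrow> d mod v \<noteq> f mod v"

text \<open>Every pair of points is in exactly three triples, that is, each nonzero difference has three third
points.\<close>
locale cyclic_kernel = cyclic_triples +
  assumes three: "d mod v \<noteq> 0 \<Longrightarrow> card {f \<in> {0..<v}. R d f} = 3"

text \<open>A Steiner triple system \<open>C\<close> on $\mathbb{Z}_v$ all of whose blocks belong to the family \<open>R\<close>; it need
not be invariant under translation. Since $3 = 1 + 2$ is the only partition of 3 into two positive
summands, a three-fold system is decomposable only if it contains such a \<open>C\<close>.\<close>
locale splitting =
  fixes v :: int and R :: "int \<Rightarrow> int \<Rightarrow> bool" and C :: "int \<Rightarrow> int \<Rightarrow> int \<Rightarrow> bool"
  assumes periodic: "C (x mod v) (y mod v) (z mod v) = C x y z"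
    and swap: "C x y z \<Longrightarrow> C y x z"
    and rotate: "C x y z \<Longrightarrow> C y z x"
    and block: "C x y z \<Longrightarrow> R (y - x) (z - x)"
    and third: "x mod v \<noteq> y mod v \<Longrightarrow> \<exists>!z. z \<in> {0..<v} \<and> C x y z"

text \<open>The blocks of the family \<open>R\<close> on the points \<open>0, \<dots>, n - 1\<close>.\<close>
definition kernel_blocks :: "nat \<Rightarrow> (int \<Rightarrow> int \<Rightarrow> bool) \<Rightarrow> nat set set" where
  "kernel_blocks n R =
     {{a, b, c} | a b c. a < n \<and> b < n \<and> c < n \<and> R (int b - int a) (int c - int a)}"

lemma kernel_mod_cong:
  assumes "cyclic_triples v R" "d mod v = d' mod v" "f mod v = f' mod v"
  shows "R d f = R d' f'"
  using cyclic_triples.periodic[OF assms(1), of d f] cyclic_triples.periodic[OF assms(1), of d' f']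
    assms(2,3) by simp

lemma kernel_distinct:
  assumes K: "cyclic_triples (int n) R" and R: "R (int b - int a) (int c - int a)"
  shows "a \<noteq> b" "a \<noteq> c" "b \<noteq> c"
  using cyclic_triples.nonzero[OF K R] cyclic_triples.distinct[OF K R]
    cyclic_triples.nonzero[OF K cyclic_triples.swap[OF K R]]
  by fastforce+

lemma kernel_triple_sym:
  fixes a b c :: int
  assumes K: "cyclic_triples v R" and R: "R (b - a) (c - a)"
  shows "R (c - a) (b - a)" "R (a - b) (c - b)" "R (c - b) (a - b)"
        "R (a - c) (b - c)" "R (b - c) (a - c)"
proof -
  show 1: "R (c - a) (b - a)" using cyclic_triples.swap[OF K R] .
  show 2: "R (a - b) (c - b)" using cyclic_triples.rebase[OF K R] by simp
  show 3: "R (c - b) (a - b)" using cyclic_triples.swap[OF K 2] .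
  show 4: "R (a - c) (b - c)" using cyclic_triples.rebase[OF K 1] by simp
  show 5: "R (b - c) (a - c)" using cyclic_triples.swap[OF K 4] .
qed

lemma mem_kernel_blocks:
  assumes K: "cyclic_triples (int n) R" and "a < n" "b < n" "c < n" and ne: "a \<noteq> b"
  shows "{a, b, c} \<in> kernel_blocks n R \<longleftrightarrow> R (int b - int a) (int c - int a)"
proof
  assume "{a, b, c} \<in> kernel_blocks n R"
  then obtain a' b' c' where eq: "{a, b, c} = {a', b', c'}"
    and R: "R (int b' - int a') (int c' - int a')"
    unfolding kernel_blocks_def by auto
  have d: "a' \<noteq> b'" "a' \<noteq> c'" "b' \<noteq> c'" using kernel_distinct[OF K R] by auto
  have "card {a, b, c} = 3" unfolding eq using d by simp
  then have "c \<noteq> a" "c \<noteq> b" using ne by (auto simp: card_insert_if split: if_splits)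
  moreover have "a \<in> {a', b', c'}" "b \<in> {a', b', c'}" "c \<in> {a', b', c'}"
    using eq by blast+
  ultimately have "a = a' \<and> b = b' \<and> c = c' \<or> a = a' \<and> b = c' \<and> c = b' \<or> a = b' \<and> b = a' \<and> c = c'
      \<or> a = b' \<and> b = c' \<and> c = a' \<or> a = c' \<and> b = a' \<and> c = b' \<or> a = c' \<and> b = b' \<and> c = a'"
    using d ne by simp argo
  then show "R (int b - int a) (int c - int a)"
    using R kernel_triple_sym[OF K R] by auto
qed (use assms in \<open>auto simp: kernel_blocks_def\<close>)

lemma kernel_blocks_card:
  assumes K: "cyclic_triples (int n) R" and "b \<in> kernel_blocks n R"
  shows "b \<subseteq> {0..<n}" "card b = 3"
proof -
  from assms(2) obtain x y z where b: "b = {x, y, z}" "x < n" "y < n" "z < n"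
    and R: "R (int y - int x) (int z - int x)"
    unfolding kernel_blocks_def by auto
  show "b \<subseteq> {0..<n}" using b by auto
  show "card b = 3" using b kernel_distinct[OF K R] by simp
qed

lemma finite_kernel_blocks: "finite (kernel_blocks n R)"
  by (rule finite_subset[of _ "Pow {0..<n}"]) (auto simp: kernel_blocks_def)

text \<open>The blocks through a pair correspond to their third points.\<close>
lemma blocks_through_pair:
  assumes S: "\<And>b. b \<in> S \<Longrightarrow> b \<subseteq> {0..<n} \<and> card b = 3" and "x < n" "y < n" "x \<noteq> y"
  shows "bij_betw (\<lambda>z. {x, y, z}) {z. z < n \<and> {x, y, z} \<in> S} {b \<in> S. {x, y} \<subseteq> b}"
proof -
  have ne: "z \<noteq> x \<and> z \<noteq> y" if "{x, y, z} \<in> S" for z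
    using S[OF that] assms(4) by (auto simp: card_insert_if split: if_splits)
  have "\<exists>z<n. b = {x, y, z}" if "b \<in> S" "{x, y} \<subseteq> b" for b
  proof -
    have b: "b \<subseteq> {0..<n}" "card b = 3" using S that by auto
    have "finite b" using b(2) card.infinite by fastforce
    then have "card (b - {x, y}) = 1" using that b assms(4) by (simp add: card_Diff_subset)
    then obtain z where z: "b - {x, y} = {z}" by (auto simp: card_1_singleton_iff)
    then have "b = {x, y, z}" using that(2) by blast
    moreover have "z < n" using z b(1) by auto
    ultimately show ?thesis by blast
  qed
  then have ex: "\<exists>z<n. b = {x, y, z}" if "b \<in> S \<and> {x, y} \<subseteq> b" for b
    using that by simp
  have "{b \<in> S. {x, y} \<subseteq> b} \<subseteq> (\<lambda>z. {x, y, z}) ` {z. z < n \<and> {x, y, z} \<in> S}"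
  proof
    fix b assume "b \<in> {b \<in> S. {x, y} \<subseteq> b}"
    then have b: "b \<in> S \<and> {x, y} \<subseteq> b" by simp
    obtain z where z: "z < n" "b = {x, y, z}" using ex[OF b] by (elim exE conjE)
    show "b \<in> (\<lambda>z. {x, y, z}) ` {z. z < n \<and> {x, y, z} \<in> S}"
      using b z by (intro image_eqI[of _ _ z]) simp_all
  qed
  moreover have "inj_on (\<lambda>z. {x, y, z}) {z. z < n \<and> {x, y, z} \<in> S}"
  proof (rule inj_onI)
    fix z z' assume "z \<in> {z. z < n \<and> {x, y, z} \<in> S}" and eq: "{x, y, z} = {x, y, z'}"
    then have "z \<noteq> x" "z \<noteq> y" using ne by auto
    moreover have "z \<in> {x, y, z'}" using eq by blast
    ultimately show "z = z'" by blast
  qed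
  moreover have "(\<lambda>z. {x, y, z}) ` {z. z < n \<and> {x, y, z} \<in> S} \<subseteq> {b \<in> S. {x, y} \<subseteq> b}"
    by blast
  ultimately show ?thesis unfolding bij_betw_def by (intro conjI subset_antisym)
qed

lemma card_third_points:
  assumes K: "cyclic_kernel (int n) R" and "x < n" "y < n" "x \<noteq> y"
  shows "card {z. z < n \<and> {x, y, z} \<in> kernel_blocks n R} = 3"
proof -
  have K0: "cyclic_triples (int n) R" using K by (rule cyclic_kernel.axioms)
  let ?F = "{f \<in> {0..<int n}. R (int y - int x) f}"
  have n: "int n > 0" using assms by simp
  have m: "(int y - int x) mod int n \<noteq> 0"
  proof -
    have "int y mod int n \<noteq> int x mod int n" using assms(2-4) by simp
    then show ?thesis by (metis mod_eq_dvd_iff mod_0_imp_dvd)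
  qed
  have "bij_betw (\<lambda>z. (int z - int x) mod int n) {z. z < n \<and> {x, y, z} \<in> kernel_blocks n R} ?F"
  proof (rule bij_betw_byWitness[where f' = "\<lambda>f. nat ((int x + f) mod int n)"])
    show "\<forall>z\<in>{z. z < n \<and> {x, y, z} \<in> kernel_blocks n R}.
            nat ((int x + (int z - int x) mod int n) mod int n) = z"
      by (auto simp: mod_simps)
    show "\<forall>f\<in>?F. (int (nat ((int x + f) mod int n)) - int x) mod int n = f"
      using n by (auto simp: mod_simps)
    show "(\<lambda>z. (int z - int x) mod int n) ` {z. z < n \<and> {x, y, z} \<in> kernel_blocks n R} \<subseteq> ?F"
    proof clarify
      fix z assume z: "z < n" "{x, y, z} \<in> kernel_blocks n R"
      have "R (int y - int x) (int z - int x)"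
        using mem_kernel_blocks[OF K0 assms(2,3) z(1) assms(4)] z(2) by simp
      then have "R (int y - int x) ((int z - int x) mod int n)"
        using kernel_mod_cong[OF K0] by (metis mod_mod_trivial)
      then show "(int z - int x) mod int n \<in> {0..<int n} \<and> R (int y - int x) ((int z - int x) mod int n)"
        using n by simp
    qed
    show "(\<lambda>f. nat ((int x + f) mod int n)) ` ?F \<subseteq> {z. z < n \<and> {x, y, z} \<in> kernel_blocks n R}"
    proof clarify
      fix f assume f: "f \<in> {0..<int n}" "R (int y - int x) f"
      let ?z = "nat ((int x + f) mod int n)"
      have zn: "?z < n" using n by (simp add: nat_less_iff)
      have "(int ?z - int x) mod int n = f mod int n" using n by (simp add: mod_simps)
      then have "R (int y - int x) (int ?z - int x)"
        using f(2) kernel_mod_cong[OF K0] by metis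
      then show "?z < n \<and> {x, y, ?z} \<in> kernel_blocks n R"
        using mem_kernel_blocks[OF K0 assms(2,3) zn assms(4)] zn by simp
    qed
  qed
  then have "card {z. z < n \<and> {x, y, z} \<in> kernel_blocks n R} = card ?F"
    by (rule bij_betw_same_card)
  also have "\<dots> = 3" using cyclic_kernel.three[OF K m] .
  finally show ?thesis .
qed

lemma kernel_triple_system:
  assumes K: "cyclic_kernel (int n) R"
  shows "triple_system 3 n {0..<n} (mset_set (kernel_blocks n R))"
proof -
  have K0: "cyclic_triples (int n) R" using K by (rule cyclic_kernel.axioms)
  show ?thesis
    unfolding triple_system_def
  proof (intro conjI allI impI ballI)
    fix e :: "nat set" assume e: "e \<subseteq> {0..<n} \<and> card e = 2"
    then obtain x y where xy: "e = {x, y}" "x \<noteq> y" by (auto simp: card_2_iff)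
    with e have lt: "x < n" "y < n" by auto
    have "size {#b \<in># mset_set (kernel_blocks n R). e \<subseteq> b#} = card {b \<in> kernel_blocks n R. {x, y} \<subseteq> b}"
      by (simp add: xy finite_kernel_blocks)
    also have "\<dots> = card {z. z < n \<and> {x, y, z} \<in> kernel_blocks n R}"
      by (rule bij_betw_same_card[OF blocks_through_pair, symmetric])
        (use kernel_blocks_card[OF K0] lt xy in auto)
    also have "\<dots> = 3" using card_third_points[OF K lt xy(2)] .
    finally show "size {#b \<in># mset_set (kernel_blocks n R). e \<subseteq> b#} = 3" .
  qed (use kernel_blocks_card[OF K0] in \<open>auto simp: finite_kernel_blocks\<close>)
qed

lemma kernel_cyclic_system:
  assumes K: "cyclic_triples (int n) R"
  shows "cyclic_system {0..<n} (mset_set (kernel_blocks n R))"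
proof -
  have n: "n > 0" using cyclic_triples.pos[OF K] by simp
  define p where "p x = (if x < n then Suc x mod n else x)" for x
  have inj: "inj p"
  proof (rule injI)
    fix x y assume "p x = p y"
    then show "x = y"
      using n by (auto simp: p_def mod_Suc split: if_splits)
  qed
  have img: "p ` {0..<n} = {0..<n}"
    by (rule endo_inj_surj) (use n inj in \<open>auto simp: p_def intro: inj_on_subset\<close>)
  have perm: "p permutes {0..<n}"
    by (rule bij_imp_permutes) (use img inj in \<open>auto simp: bij_betw_def p_def intro: inj_on_subset\<close>)
  have "(`) p ` kernel_blocks n R = kernel_blocks n R"
  proof (rule endo_inj_surj[OF finite_kernel_blocks])
    show "inj_on ((`) p) (kernel_blocks n R)"
      using inj_on_image[of p "kernel_blocks n R"] inj by (meson inj_on_subset subset_UNIV)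
    show "(`) p ` kernel_blocks n R \<subseteq> kernel_blocks n R"
    proof clarify
      fix b assume "b \<in> kernel_blocks n R"
      then obtain x y z where b: "b = {x, y, z}" "x < n" "y < n" "z < n"
        and R: "R (int y - int x) (int z - int x)"
        unfolding kernel_blocks_def by auto
      have shift: "(int (p y') - int (p x')) mod int n = (int y' - int x') mod int n"
        if "x' < n" "y' < n" for x' y'
        using that by (simp add: p_def zmod_int mod_simps)
      have "R (int (p y) - int (p x)) (int (p z) - int (p x))"
        using kernel_mod_cong[OF K shift[OF b(2,3)] shift[OF b(2,4)]] R by simp
      moreover have "p x < n" "p y < n" "p z < n" using b n by (auto simp: p_def)
      ultimately show "p ` b \<in> kernel_blocks n R"
        unfolding kernel_blocks_def b(1) by auto
    qed
  qed
  moreover have "inj_on ((`) p) (kernel_blocks n R)"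
    using inj_on_image[of p "kernel_blocks n R"] inj by (meson inj_on_subset subset_UNIV)
  ultimately have "image_mset ((`) p) (mset_set (kernel_blocks n R)) = mset_set (kernel_blocks n R)"
    by (simp add: image_mset_mset_set)
  with perm have "p \<in> automorphisms {0..<n} (mset_set (kernel_blocks n R))"
    by (simp add: automorphisms_def)
  moreover have "cyclic_on p {0..<n}"
  proof -
    have orb: "Suc k mod n \<in> orbit p 0" for k
    proof (induction k)
      case 0
      have "p 0 = Suc 0 mod n" using n by (simp only: p_def if_True)
      with orbit.base[of p 0] show ?case by (simp only:)
    next
      case (Suc k)
      have "p (Suc k mod n) = Suc (Suc k) mod n" using n by (simp add: p_def mod_Suc_eq)
      with orbit.step[OF Suc] show ?case by simp
    qed
    have "{0..<n} \<subseteq> orbit p 0"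
    proof
      fix k assume "k \<in> {0..<n}"
      then have "Suc (k + n - 1) mod n = k" using n by simp
      with orb[of "k + n - 1"] show "k \<in> orbit p 0" by simp
    qed
    moreover have "orbit p 0 \<subseteq> {0..<n}"
      using permutes_orbit_subset[OF perm] n by simp
    ultimately have "{0..<n} = orbit p 0" by (rule subset_antisym)
    moreover have "0 \<in> {0..<n}" using n by simp
    ultimately show ?thesis unfolding cyclic_on_def by (intro bexI)
  qed
  ultimately show ?thesis unfolding cyclic_system_def by (intro bexI)
qed

text \<open>A $TS_1$ inside the block multiset is read off as a Steiner triple system on integer
representatives.\<close>
lemma splitting_of_subsystem:
  assumes K: "cyclic_triples (int n) R"
    and T: "triple_system 1 n {0..<n} B" and sub: "B \<subseteq># mset_set (kernel_blocks n R)"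
  shows "\<exists>C. splitting (int n) R C"
proof -
  have n: "int n > 0" using cyclic_triples.pos[OF K] by simp
  define r where "r x = nat (x mod int n)" for x
  have r_lt: "r x < n" for x using n by (simp add: r_def nat_less_iff)
  have r_eq: "r x = r y \<longleftrightarrow> x mod int n = y mod int n" for x y
    using n by (simp add: r_def eq_nat_nat_iff)
  have r_int: "int (r x) = x mod int n" for x using n by (simp add: r_def)
  have le1: "count B b \<le> 1" for b
  proof -
    have "count B b \<le> count (mset_set (kernel_blocks n R)) b"
      using sub by (rule mset_subset_eq_count)
    also have "\<dots> \<le> 1" by (simp add: finite_kernel_blocks count_mset_set')
    finally show ?thesis .
  qed
  have B: "B = mset_set (set_mset B)"
  proof (rule multiset_eqI)
    fix b show "count B b = count (mset_set (set_mset B)) b"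
      using le1[of b] by (cases "b \<in># B") (auto simp: count_mset_set' count_eq_zero_iff le_Suc_eq)
  qed
  have subset: "set_mset B \<subseteq> kernel_blocks n R"
    using set_mset_mono[OF sub] by (simp add: finite_kernel_blocks)
  have blk: "b \<subseteq> {0..<n} \<and> card b = 3" if "b \<in> set_mset B" for b
    using T that unfolding triple_system_def by blast
  define C where "C x y z \<longleftrightarrow> {r x, r y, r z} \<in> set_mset B" for x y z
  have "splitting (int n) R C"
  proof
    show "C (x mod int n) (y mod int n) (z mod int n) = C x y z" for x y z
      by (simp add: C_def r_def)
    show "C y x z" if "C x y z" for x y z using that by (simp add: C_def insert_commute)
    show "C y z x" if "C x y z" for x y z using that by (simp add: C_def insert_commute)
    show "R (y - x) (z - x)" if "C x y z" for x y z
    proof -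
      have b: "{r x, r y, r z} \<in> set_mset B" using that by (simp add: C_def)
      then have "r x \<noteq> r y" using blk[OF b] by (auto simp: card_insert_if split: if_splits)
      then have "R (int (r y) - int (r x)) (int (r z) - int (r x))"
        using mem_kernel_blocks[OF K r_lt r_lt r_lt] b subset by blast
      moreover have "(int (r y') - int (r x')) mod int n = (y' - x') mod int n" for x' y'
        by (simp add: r_int mod_simps)
      ultimately show ?thesis using kernel_mod_cong[OF K] by blast
    qed
    show "\<exists>!z. z \<in> {0..<int n} \<and> C x y z" if "x mod int n \<noteq> y mod int n" for x y
    proof -
      have ne: "r x \<noteq> r y" using that by (simp add: r_eq)
      have "card {r x, r y} = 2" using ne by simp
      moreover have "{r x, r y} \<subseteq> {0..<n}" using r_lt by simp
      ultimately have "size {#b \<in># B. {r x, r y} \<subseteq> b#} = 1"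
        using T unfolding triple_system_def by blast
      moreover have "size (mset_set {b \<in> set_mset B. {r x, r y} \<subseteq> b})
          = size {#b \<in># mset_set (set_mset B). {r x, r y} \<subseteq> b#}"
        by (subst filter_mset_mset_set) simp_all
      ultimately have "card {b \<in> set_mset B. {r x, r y} \<subseteq> b} = 1"
        by (simp only: B[symmetric] size_mset_set)
      moreover have "bij_betw (\<lambda>z. {r x, r y, z}) {z. z < n \<and> {r x, r y, z} \<in> set_mset B}
          {b \<in> set_mset B. {r x, r y} \<subseteq> b}"
        by (rule blocks_through_pair) (use blk ne r_lt in auto)
      ultimately have "card {z. z < n \<and> {r x, r y, z} \<in> set_mset B} = 1"
        using bij_betw_same_card by fastforce
      then obtain z where z: "{z. z < n \<and> {r x, r y, z} \<in> set_mset B} = {z}"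
        by (auto simp: card_1_singleton_iff)
      show ?thesis
      proof (rule ex1I[of _ "int z"])
        have "z < n \<and> {r x, r y, z} \<in> set_mset B" using z by blast
        then show "int z \<in> {0..<int n} \<and> C x y (int z)" by (simp add: C_def r_def)
      next
        fix t assume t: "t \<in> {0..<int n} \<and> C x y t"
        then have "r t = nat t" by (simp add: r_def)
        then have "nat t \<in> {z. z < n \<and> {r x, r y, z} \<in> set_mset B}"
          using t r_lt[of t] by (simp add: C_def)
        then have "nat t = z" using z by blast
        then show "t = int z" using t by auto
      qed
    qed
  qed
  then show ?thesis by blast
qed

theorem indecomposable_system_of_kernel:
  assumes K: "cyclic_kernel (int n) R" and "\<And>C. \<not> splitting (int n) R C"
  shows "\<exists>(V :: nat set) B. triple_system 3 n V B \<and> cyclic_system V B \<and>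
           simple_system B \<and> indecomposable_system 3 n V B"
proof (intro exI conjI)
  have K0: "cyclic_triples (int n) R" using K by (rule cyclic_kernel.axioms)
  let ?B = "mset_set (kernel_blocks n R)"
  show "triple_system 3 n {0..<n} ?B" by (rule kernel_triple_system[OF K])
  show "cyclic_system {0..<n} ?B" by (rule kernel_cyclic_system[OF K0])
  show "simple_system ?B" by (simp add: simple_system_def finite_kernel_blocks count_mset_set')
  show "indecomposable_system 3 n {0..<n} ?B"
  proof
    assume "decomposable_system 3 n {0..<n} ?B"
    then obtain l1 l2 B1 B2 where l: "l1 \<ge> 1" "l2 \<ge> 1" "l1 + l2 = 3" and B: "B1 + B2 = ?B"
      and T: "triple_system l1 n {0..<n} B1" "triple_system l2 n {0..<n} B2"
      unfolding decomposable_system_def by blast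
    have "B1 \<subseteq># ?B" "B2 \<subseteq># ?B" unfolding B[symmetric] by simp_all
    moreover have "l1 = 1 \<or> l2 = 1" using l by linarith
    ultimately obtain B' where "triple_system 1 n {0..<n} B'" "B' \<subseteq># ?B" using T by auto
    then show False using splitting_of_subsystem[OF K0] assms(2) by blast
  qed
qed

section \<open>Arithmetic progressions\<close>

lemma (in cyclic_triples) cong:
  assumes "[d = d'] (mod v)" "[f = f'] (mod v)"
  shows "R d f \<longleftrightarrow> R d' f'"
  using periodic[of d f] periodic[of d' f'] assms by (simp add: cong_def)

lemma cyclic_triples_union:
  assumes "cyclic_triples v R" "cyclic_triples v R'"
  shows "cyclic_triples v (\<lambda>d f. R d f \<or> R' d f)"
proof -
  interpret R: cyclic_triples v R by fact
  interpret R': cyclic_triples v R' by fact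
  show ?thesis
  proof
    show "R d f \<or> R' d f \<Longrightarrow> R f d \<or> R' f d" for d f
      using R.swap R'.swap by blast
    show "R d f \<or> R' d f \<Longrightarrow> R (- d) (f - d) \<or> R' (- d) (f - d)" for d f
      using R.rebase R'.rebase by blast
    show "R d f \<or> R' d f \<Longrightarrow> d mod v \<noteq> 0" for d f
      using R.nonzero[of d f] R'.nonzero[of d f] by auto
    show "R d f \<or> R' d f \<Longrightarrow> d mod v \<noteq> f mod v" for d f
      using R.distinct[of d f] R'.distinct[of d f] by auto
  qed (simp_all add: R.pos R.periodic R'.periodic)
qed

lemma card_three_residues:
  fixes v a b c :: int
  assumes "v > 0" and P: "\<And>f. P f \<longleftrightarrow> [f = a] (mod v) \<or> [f = b] (mod v) \<or> [f = c] (mod v)"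
    and ne: "\<not> [a = b] (mod v)" "\<not> [a = c] (mod v)" "\<not> [b = c] (mod v)"
  shows "card {f \<in> {0..<v}. P f} = 3"
proof -
  have "{f \<in> {0..<v}. P f} = {a mod v, b mod v, c mod v}"
    using \<open>v > 0\<close> by (auto simp: P cong_def)
  moreover have "a mod v \<noteq> b mod v" "a mod v \<noteq> c mod v" "b mod v \<noteq> c mod v"
    using ne by (simp_all add: cong_def)
  ultimately show ?thesis by simp
qed

lemma cong_double_iff:
  fixes v x y :: int assumes "odd v"
  shows "[2 * x = 2 * y] (mod v) \<longleftrightarrow> [x = y] (mod v)"
  using assms by (intro cong_mult_lcancel) (simp add: coprime_commute)

text \<open>The three-term arithmetic progressions \<open>{x, x + i, x + 2 * i}\<close> with step \<open>i \<notin> S\<close>. The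
three disjuncts list the possible positions of the base point and of the second point, up to the sign
of the step: the base point is an end and \<open>d\<close> is the step, or the base point is in the middle, or the
base point is an end and \<open>d\<close> is twice the step. The set \<open>S\<close> is meant to be closed under negation and under congruence.\<close>
definition ap_triples :: "int \<Rightarrow> int set \<Rightarrow> int \<Rightarrow> int \<Rightarrow> bool" where
  "ap_triples v S d f \<longleftrightarrow> \<not> [d = 0] (mod v) \<and>
     (d \<notin> S \<and> ([f = 2 * d] (mod v) \<or> [f = - d] (mod v)) \<or> f \<notin> S \<and> [d = 2 * f] (mod v))"

lemma cyclic_ap_triples:
  assumes "v > 0" "odd v" and per: "\<And>x. x mod v \<in> S \<longleftrightarrow> x \<in> S" and neg: "\<And>x. - x \<in> S \<longleftrightarrow> x \<in> S"
  shows "cyclic_triples v (ap_triples v S)"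
proof -
  have S: "x \<in> S \<longleftrightarrow> y \<in> S" if "[x = y] (mod v)" for x y
    using per[of x] per[of y] that by (simp add: cong_def)
  have zero: "[2 * x = 0] (mod v) \<longleftrightarrow> [x = 0] (mod v)" for x
    using cong_double_iff[OF \<open>odd v\<close>, of x 0] by simp
  show ?thesis
  proof
    show "v > 0" by fact
    show "ap_triples v S (d mod v) (f mod v) = ap_triples v S d f" for d f
      by (simp add: ap_triples_def per cong_def mod_simps)
    show "d mod v \<noteq> 0" if "ap_triples v S d f" for d f
      using that by (simp add: ap_triples_def cong_def)
    show "d mod v \<noteq> f mod v" if "ap_triples v S d f" for d f
    proof
      assume "d mod v = f mod v"
      then have "[d = f] (mod v)" by (simp add: cong_def)
      then have df: "v dvd d - f" by (simp add: cong_iff_dvd_diff)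
      have d: "\<not> v dvd d" "\<not> v dvd 2 * d"
        using that zero[of d] by (simp_all add: ap_triples_def cong_iff_dvd_diff)
      from that consider "v dvd f - 2 * d" | "v dvd f + d" | "v dvd d - 2 * f"
        by (auto simp: ap_triples_def cong_iff_dvd_diff)
      then show False
      proof cases
        case 1
        from dvd_add[OF df 1] d(1) show False by simp
      next
        case 2
        from dvd_add[OF df 2] d(2) show False by simp
      next
        case 3
        from dvd_diff[OF dvd_mult[OF df, of 2] 3] d(1) show False by simp
      qed
    qed
    show "ap_triples v S f d" if R: "ap_triples v S d f" for d f
    proof -
      have d: "\<not> [d = 0] (mod v)" using R by (simp add: ap_triples_def)
      consider "d \<notin> S" "[f = 2 * d] (mod v)" | "d \<notin> S" "[f = - d] (mod v)" | "f \<notin> S" "[d = 2 * f] (mod v)"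
        using R unfolding ap_triples_def by blast
      then show ?thesis
      proof cases
        case 1
        then have "\<not> [f = 0] (mod v)" using d zero[of d] by (metis cong_sym cong_trans)
        with 1 show ?thesis by (simp add: ap_triples_def)
      next
        case 2
        then have "\<not> [f = 0] (mod v)" using d by (metis cong_minus_minus_iff cong_sym cong_trans minus_zero)
        moreover have "[d = - f] (mod v)" using 2(2) by (simp add: cong_iff_dvd_diff algebra_simps)
        moreover have "f \<notin> S" using 2 S neg by blast
        ultimately show ?thesis by (simp add: ap_triples_def)
      next
        case 3
        then have "\<not> [f = 0] (mod v)" using d zero[of f] by (metis cong_sym cong_trans)
        with 3 show ?thesis by (simp add: ap_triples_def)
      qed
    qed
    show "ap_triples v S (- d) (f - d)" if R: "ap_triples v S d f" for d f
    proof -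
      have d: "\<not> [- d = 0] (mod v)" using R by (simp add: ap_triples_def cong_iff_dvd_diff)
      consider "d \<notin> S" "[f = 2 * d] (mod v)" | "d \<notin> S" "[f = - d] (mod v)" | "f \<notin> S" "[d = 2 * f] (mod v)"
        using R unfolding ap_triples_def by blast
      then show ?thesis
      proof cases
        case 1
        then have "[f - d = - (- d)] (mod v)" by (simp add: cong_iff_dvd_diff algebra_simps)
        with 1 d neg show ?thesis by (simp add: ap_triples_def)
      next
        case 2
        then have "[f - d = 2 * (- d)] (mod v)" by (simp add: cong_iff_dvd_diff algebra_simps)
        with 2 d neg show ?thesis by (simp add: ap_triples_def)
      next
        case 3
        have dvd: "v dvd 2 * f - d" using 3 by (metis cong_iff_dvd_diff cong_sym)
        then have "[f - d = - f] (mod v)" by (simp add: cong_iff_dvd_diff algebra_simps)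
        then have "f - d \<notin> S" using 3 S neg by blast
        moreover have "[- d = 2 * (f - d)] (mod v)"
          using 3(2) by (simp add: cong_iff_dvd_diff algebra_simps)
        ultimately show ?thesis using d by (simp add: ap_triples_def)
      qed
    qed
  qed
qed

lemma cong_half:
  fixes v d :: int assumes "odd v"
  shows "\<exists>h. \<forall>f. [d = 2 * f] (mod v) \<longleftrightarrow> [f = h] (mod v)"
proof -
  have "2 * ((v + 1) div 2) = v + 1" using assms by presburger
  then have "2 * ((v + 1) div 2 * d) = (v + 1) * d" by (simp only: mult.assoc[symmetric])
  then have "[2 * ((v + 1) div 2 * d) = d] (mod v)"
    by (simp only: cong_iff_dvd_diff) (simp add: algebra_simps)
  then have "[d = 2 * f] (mod v) \<longleftrightarrow> [2 * f = 2 * ((v + 1) div 2 * d)] (mod v)" for f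
    by (metis cong_sym cong_trans)
  then show ?thesis using cong_double_iff[OF assms] by auto
qed

text \<open>The third points for the difference \<open>d\<close> are \<open>2 * d\<close>, \<open>- d\<close> and half of \<open>d\<close>, which are distinct unless
\<open>3 * d\<close> vanishes.\<close>
lemma ap_triples_three:
  assumes "v > 0" "odd v" and d: "\<not> [3 * d = 0] (mod v)" and S: "d \<notin> S" "\<And>f. [d = 2 * f] (mod v) \<Longrightarrow> f \<notin> S"
  shows "card {f \<in> {0..<v}. ap_triples v S d f} = 3"
proof -
  obtain h where h: "\<And>f. [d = 2 * f] (mod v) \<longleftrightarrow> [f = h] (mod v)"
    using cong_half[OF \<open>odd v\<close>, of d] by blast
  have dh: "v dvd d - 2 * h" using h[of h] by (simp add: cong_iff_dvd_diff)
  have d3: "\<not> v dvd 3 * d" using d by (simp add: cong_iff_dvd_diff)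
  show ?thesis
  proof (rule card_three_residues[OF \<open>v > 0\<close>])
    have "\<not> v dvd d" using d3 dvd_mult by blast
    then show "ap_triples v S d f \<longleftrightarrow> [f = 2 * d] (mod v) \<or> [f = - d] (mod v) \<or> [f = h] (mod v)" for f
      using S h unfolding ap_triples_def by (auto simp: cong_iff_dvd_diff[of d 0])
    show "\<not> [2 * d = - d] (mod v)" using d3 by (simp add: cong_iff_dvd_diff)
    show "\<not> [2 * d = h] (mod v)"
    proof
      assume "[2 * d = h] (mod v)"
      then have "v dvd 2 * d - h" by (simp add: cong_iff_dvd_diff)
      from dvd_diff[OF dvd_mult[OF this, of 2] dh] have "v dvd 2 * (2 * d - h) - (d - 2 * h)" .
      with d3 show False by simp
    qed
    show "\<not> [- d = h] (mod v)"
    proof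
      assume "[- d = h] (mod v)"
      then have "v dvd - d - h" by (simp add: cong_iff_dvd_diff)
      from dvd_diff[OF dh dvd_mult[OF this, of 2]] have "v dvd (d - 2 * h) - 2 * (- d - h)" .
      with d3 show False by simp
    qed
  qed
qed

lemma ap_kernel:
  assumes "v > 0" "odd v" "\<not> 3 dvd v"
  shows "cyclic_kernel v (ap_triples v {})"
proof -
  interpret cyclic_triples v "ap_triples v {}" by (rule cyclic_ap_triples) (use assms in auto)
  show ?thesis
  proof
    fix d assume "d mod v \<noteq> 0"
    then have "\<not> v dvd d" by auto
    moreover have "coprime v 3"
      using prime_imp_coprime[of 3 v] assms(3) by (simp add: coprime_commute)
    ultimately have "\<not> v dvd 3 * d" by (simp add: coprime_dvd_mult_right_iff)
    then show "card {f \<in> {0..<v}. ap_triples v {} d f} = 3"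
      by (intro ap_triples_three) (use assms in \<open>auto simp: cong_iff_dvd_diff\<close>)
  qed
qed

context splitting
begin

lemma cong:
  assumes "[x = x'] (mod v)" "[y = y'] (mod v)" "[z = z'] (mod v)"
  shows "C x y z \<longleftrightarrow> C x' y' z'"
  using periodic[of x y z] periodic[of x' y' z'] assms by (simp add: cong_def)

lemma third_exists:
  assumes "\<not> [x = y] (mod v)"
  obtains z where "C x y z" "R (y - x) (z - x)"
proof -
  from third[of x y] assms obtain z where z: "C x y z" by (auto simp: cong_def)
  show thesis by (rule that[OF z block[OF z]])
qed

lemma third_unique:
  assumes "v > 0" "C x y z" "C x y z'" "\<not> [x = y] (mod v)"
  shows "[z = z'] (mod v)"
proof -
  have "C x y (z mod v)" "C x y (z' mod v)"
    using assms(2,3) cong[of x x y y z "z mod v"] cong[of x x y y z' "z' mod v"]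
    by (simp_all add: cong_def)
  moreover have "z mod v \<in> {0..<v}" "z' mod v \<in> {0..<v}" using \<open>v > 0\<close> by simp_all
  moreover have "x mod v \<noteq> y mod v" using assms(4) by (simp add: cong_def)
  ultimately show ?thesis using third[of x y] unfolding cong_def by blast
qed

end

lemma card_shift_residues:
  fixes v c :: int
  assumes "v > 0" and per: "\<And>x. P (x mod v) \<longleftrightarrow> P x"
  shows "card {x \<in> {0..<v}. P (x + c)} = card {x \<in> {0..<v}. P x}"
proof (rule bij_betw_same_card[of "\<lambda>x. (x + c) mod v"],
    rule bij_betw_byWitness[where f' = "\<lambda>x. (x - c) mod v"])
  show "\<forall>x\<in>{x \<in> {0..<v}. P (x + c)}. ((x + c) mod v - c) mod v = x"
    by (simp add: mod_simps)
  show "\<forall>x\<in>{x \<in> {0..<v}. P x}. ((x - c) mod v + c) mod v = x"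
    by (simp add: mod_simps)
  show "(\<lambda>x. (x + c) mod v) ` {x \<in> {0..<v}. P (x + c)} \<subseteq> {x \<in> {0..<v}. P x}"
    using \<open>v > 0\<close> by (auto simp: per)
  have "P ((x - c) mod v + c)" if "P x" for x
    using per[of "(x - c) mod v + c"] per[of x] that by (simp add: mod_simps)
  then show "(\<lambda>x. (x - c) mod v) ` {x \<in> {0..<v}. P x} \<subseteq> {x \<in> {0..<v}. P (x + c)}"
    using \<open>v > 0\<close> by auto
qed

text \<open>Let \<open>n e\<close> be the number of chosen progressions with step \<open>e\<close>. A pair with difference \<open>2 * e\<close> is
covered either by a progression of step \<open>2 * e\<close> in which it is the first or the last pair, or as the
outer pair of a progression of step \<open>e\<close>.\<close>
lemma ap_step_count:
  assumes "splitting v (ap_triples v {}) C" and v: "v > 0" "odd v" "\<not> 3 dvd v" and e: "\<not> v dvd e"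
  defines "n \<equiv> \<lambda>e. card {x \<in> {0..<v}. C x (x + e) (x + 2 * e)}"
  shows "2 * n (2 * e) + n e = nat v"
proof -
  interpret splitting v "ap_triples v {}" C by fact
  let ?A = "{x \<in> {0..<v}. C x (x + e) (x + 2 * e)}"
  let ?B = "{x \<in> {0..<v}. C x (x + 2 * e) (x + 4 * e)}"
  let ?B' = "{x \<in> {0..<v}. C (x - 2 * e) x (x + 2 * e)}"
  have e2: "\<not> v dvd 2 * e" "\<not> v dvd 3 * e"
  proof -
    have "coprime v 3" using prime_imp_coprime[of 3 v] v(3) by (simp add: coprime_commute)
    moreover have "coprime v 2" using v(2) by simp
    ultimately show "\<not> v dvd 2 * e" "\<not> v dvd 3 * e" using e by (simp_all add: coprime_dvd_mult_right_iff)
  qed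
  \<comment> \<open>The three candidates for the third point of a pair \<open>x, x + 2 * e\<close> differ by \<open>3 * e\<close> or \<open>6 * e\<close>.\<close>
  have e6: "\<not> v dvd 6 * e"
    using e2(2) cong_double_iff[OF v(2), of "3 * e" 0] by (simp add: cong_iff_dvd_diff)
  have ne: "\<not> [x = x + 2 * e] (mod v)" for x using e2 by (simp add: cong_iff_dvd_diff)
  have B': "C (x - 2 * e) x (x + 2 * e) \<longleftrightarrow> C x (x + 2 * e) (x - 2 * e)" for x
    using rotate[of "x - 2 * e" x "x + 2 * e"] rotate[OF rotate[of x "x + 2 * e" "x - 2 * e"]] by blast
  have A: "C x (x + e) (x + 2 * e) \<longleftrightarrow> C x (x + 2 * e) (x + e)" for x
    using swap[OF rotate[OF rotate[of x "x + e" "x + 2 * e"]]]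
      swap[OF rotate[OF rotate[of x "x + 2 * e" "x + e"]]] by blast
  have cover: "x \<in> ?A \<union> ?B \<union> ?B'" if x: "x \<in> {0..<v}" for x
  proof -
    obtain z where z: "C x (x + 2 * e) z" and R: "ap_triples v {} (2 * e) (z - x)"
      using third_exists[OF ne[of x]] by auto
    consider "[z - x = 4 * e] (mod v)" | "[z - x = - (2 * e)] (mod v)" | "[2 * e = 2 * (z - x)] (mod v)"
      using R by (auto simp: ap_triples_def)
    then show ?thesis
    proof cases
      case 1
      then have "[z = x + 4 * e] (mod v)" by (simp add: cong_iff_dvd_diff algebra_simps)
      with z cong[OF cong_refl cong_refl this] x show ?thesis by simp
    next
      case 2
      then have "[z = x - 2 * e] (mod v)" by (simp add: cong_iff_dvd_diff algebra_simps)
      with z cong[OF cong_refl cong_refl this] x show ?thesis by (simp add: B')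
    next
      case 3
      then have "[e = z - x] (mod v)" using cong_double_iff[OF v(2)] by blast
      then have "[z - x = e] (mod v)" by (rule cong_sym)
      then have "[z = x + e] (mod v)" by (simp add: cong_iff_dvd_diff algebra_simps)
      with z cong[OF cong_refl cong_refl this] x show ?thesis by (simp add: A)
    qed
  qed
  then have union: "?A \<union> ?B \<union> ?B' = {0..<v}" by blast
  have disj: "?A \<inter> ?B = {}" "(?A \<union> ?B) \<inter> ?B' = {}"
  proof -
    have inc: "\<not> [x + e = x + 4 * e] (mod v)" "\<not> [x + e = x - 2 * e] (mod v)"
      "\<not> [x + 4 * e = x - 2 * e] (mod v)" for x
      using e2 e6 by (simp_all add: cong_iff_dvd_diff)
    have "\<not> (C x (x + 2 * e) (x + e) \<and> C x (x + 2 * e) (x + 4 * e))"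
      "\<not> (C x (x + 2 * e) (x + e) \<and> C x (x + 2 * e) (x - 2 * e))"
      "\<not> (C x (x + 2 * e) (x + 4 * e) \<and> C x (x + 2 * e) (x - 2 * e))" for x
      using third_unique[OF v(1) _ _ ne[of x]] inc[of x] by blast+
    then show "?A \<inter> ?B = {}" "(?A \<union> ?B) \<inter> ?B' = {}" unfolding A B' by blast+
  qed
  have fin: "finite ?A" "finite ?B" "finite ?B'"
    by (rule finite_subset[OF Collect_restrict finite_atLeastLessThan_int])+
  have "card (?A \<union> ?B \<union> ?B') = card (?A \<union> ?B) + card ?B'"
    by (rule card_Un_disjoint[OF finite_UnI[OF fin(1,2)] fin(3) disj(2)])
  also have "card (?A \<union> ?B) = card ?A + card ?B"
    by (rule card_Un_disjoint[OF fin(1,2) disj(1)])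
  finally have "card ?A + card ?B + card ?B' = card {0..<v}" by (simp only: union)
  moreover have "card ?B' = card ?B"
  proof -
    have "card {x \<in> {0..<v}. C (x + 2 * e - 2 * e) (x + 2 * e) (x + 2 * e + 2 * e)} = card ?B'"
      by (rule card_shift_residues[OF v(1), of "\<lambda>x. C (x - 2 * e) x (x + 2 * e)"])
        (rule cong; simp add: cong_def mod_simps)
    then show ?thesis by (simp add: algebra_simps)
  qed
  ultimately show ?thesis by (simp add: n_def algebra_simps)
qed

text \<open>At a largest and a smallest value \<open>M\<close> and \<open>m\<close> of \<open>n\<close> the count gives \<open>2 * M + m \<le> v \<le> 2 * m + M\<close>, so
\<open>n\<close> is constant with value $v/3$, which is not an integer.\<close>
lemma ap_no_splitting:
  assumes "splitting v (ap_triples v {}) C" and v: "v > 1" "odd v" "\<not> 3 dvd v"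
  shows False
proof -
  interpret splitting v "ap_triples v {}" C by fact
  define n where "n e = int (card {x \<in> {0..<v}. C x (x + e) (x + 2 * e)})" for e
  have step: "2 * n (2 * e) + n e = v" if "\<not> v dvd e" for e
    using ap_step_count[OF assms(1) _ v(2,3) that] v(1) unfolding n_def by linarith
  have n_mod: "n (e mod v) = n e" for e
  proof -
    have "C x (x + e mod v) (x + 2 * (e mod v)) \<longleftrightarrow> C x (x + e) (x + 2 * e)" for x
      by (intro cong cong_refl cong_add cong_scalar_left) (simp_all add: cong_def)
    then show ?thesis by (simp add: n_def)
  qed
  let ?N = "n ` {1..<v}"
  have fin: "finite ?N" "?N \<noteq> {}" using v(1) by auto
  have mem: "n e \<in> ?N" if "\<not> v dvd e" for e
  proof -
    have "e mod v \<noteq> 0" using that by (simp add: dvd_eq_mod_eq_0)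
    moreover have "0 \<le> e mod v" "e mod v < v" using v(1) by simp_all
    ultimately have "1 \<le> e mod v \<and> e mod v < v" by linarith
    then have "e mod v \<in> {1..<v}" by simp
    then have "n (e mod v) \<in> ?N" by (rule imageI)
    then show ?thesis by (simp only: n_mod)
  qed
  have half: "\<exists>e'. \<not> v dvd e' \<and> 2 * n e + n e' = v" if "e \<in> {1..<v}" for e
  proof -
    obtain h where h: "[e = 2 * h] (mod v)" using cong_half[OF v(2), of e] cong_refl by blast
    have "\<not> v dvd e" using that zdvd_not_zless by auto
    moreover have "v dvd e - 2 * h" using h by (simp add: cong_iff_dvd_diff)
    ultimately have "\<not> v dvd h" using dvd_add[of v "e - 2 * h" "2 * h"] by auto
    moreover have "n e = n (2 * h)" using h n_mod[of e] n_mod[of "2 * h"] by (simp add: cong_def)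
    ultimately show ?thesis using step[of h] by auto
  qed
  have "Max ?N \<in> ?N" "Min ?N \<in> ?N" by (rule Max_in[OF fin] Min_in[OF fin])+
  obtain a where a: "a \<in> {1..<v}" "Max ?N = n a" using \<open>Max ?N \<in> ?N\<close> by (rule imageE) simp
  obtain b where b: "b \<in> {1..<v}" "Min ?N = n b" using \<open>Min ?N \<in> ?N\<close> by (rule imageE) simp
  obtain e1 where e1: "2 * Max ?N + n e1 = v" "\<not> v dvd e1" unfolding a(2) using half[OF a(1)] by blast
  obtain e2 where e2: "2 * Min ?N + n e2 = v" "\<not> v dvd e2" unfolding b(2) using half[OF b(1)] by blast
  have "Min ?N \<le> n e1" "n e2 \<le> Max ?N" by (rule Min_le[OF fin(1) mem[OF e1(2)]] Max_ge[OF fin(1) mem[OF e2(2)]])+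
  moreover have "Min ?N \<le> Max ?N" by (rule Min_le[OF fin(1) Max_in[OF fin]])
  ultimately have "3 * Max ?N = v" using e1(1) e2(1) by linarith
  then show False using v(3) by (metis dvd_triv_left)
qed

text \<open>A Steiner triple system inside \<open>R\<close> restricts to the subgroup of the multiples of \<open>k\<close>, provided that
the triples of \<open>R\<close> meeting this subgroup twice are contained in it.\<close>
lemma splitting_restrict:
  assumes "splitting (k * w) R C" and kw: "k > 0" "w > 0"
    and closed: "\<And>d f. R (k * d) f \<Longrightarrow> k dvd f"
    and sub: "\<And>d f. R (k * d) (k * f) \<Longrightarrow> R' d f"
  shows "splitting w R' (\<lambda>x y z. C (k * x) (k * y) (k * z))"
proof -
  interpret splitting "k * w" R C by fact
  show ?thesis
  proof
    show "C (k * (x mod w)) (k * (y mod w)) (k * (z mod w)) = C (k * x) (k * y) (k * z)" for x y z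
      by (rule cong) (simp_all add: cong_def)
    show "R' (y - x) (z - x)" if "C (k * x) (k * y) (k * z)" for x y z
      using sub[of "y - x" "z - x"] block[OF that] by (simp add: algebra_simps)
    show "C (k * y) (k * x) (k * z)" if "C (k * x) (k * y) (k * z)" for x y z
      using that by (rule swap)
    show "C (k * y) (k * z) (k * x)" if "C (k * x) (k * y) (k * z)" for x y z
      using that by (rule rotate)
    fix x y assume "x mod w \<noteq> y mod w"
    then have "(k * x) mod (k * w) \<noteq> (k * y) mod (k * w)" using kw by simp
    then have ex1: "\<exists>!z. z \<in> {0..<k * w} \<and> C (k * x) (k * y) z" by (rule third)
    then obtain z where z: "z \<in> {0..<k * w}" "C (k * x) (k * y) z" by blast
    have "k dvd z - k * x" using closed[of "y - x" "z - k * x"] block[OF z(2)] by (simp add: algebra_simps)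
    then have "k dvd z" by (simp add: dvd_diff_left_iff)
    then obtain z' where z': "z = k * z'" by blast
    show "\<exists>!z. z \<in> {0..<w} \<and> C (k * x) (k * y) (k * z)"
    proof (rule ex1I[of _ z'])
      show "z' \<in> {0..<w} \<and> C (k * x) (k * y) (k * z')"
        using z z' kw by (auto simp: zero_le_mult_iff)
      fix t assume "t \<in> {0..<w} \<and> C (k * x) (k * y) (k * t)"
      then have "k * t \<in> {0..<k * w} \<and> C (k * x) (k * y) (k * t)" using kw by simp
      with ex1 z z' have "k * t = k * z'" by blast
      with kw show "t = z'" by simp
    qed
  qed
qed

section \<open>Lifting a system from a subgroup\<close>

text \<open>The family \<open>R\<close> of $\mathbb{Z}_w$ transported to the subgroup of the multiples of \<open>k\<close> in
$\mathbb{Z}_{kw}$.\<close>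
definition scaled_triples :: "int \<Rightarrow> (int \<Rightarrow> int \<Rightarrow> bool) \<Rightarrow> int \<Rightarrow> int \<Rightarrow> bool" where
  "scaled_triples k R d f \<longleftrightarrow> (\<exists>d' f'. d = k * d' \<and> f = k * f' \<and> R d' f')"

lemma scaled_triples_mult [simp]:
  "k > 0 \<Longrightarrow> scaled_triples k R (k * d) (k * f) \<longleftrightarrow> R d f"
  by (auto simp: scaled_triples_def)

lemma cyclic_scaled_triples:
  assumes "cyclic_triples w R" "k > 0"
  shows "cyclic_triples (k * w) (scaled_triples k R)"
proof -
  interpret R: cyclic_triples w R by fact
  have iff: "k dvd x mod (k * w) \<longleftrightarrow> k dvd x" for x by (simp add: dvd_mod_iff)
  show ?thesis
  proof
    show "k * w > 0" using \<open>k > 0\<close> R.pos by simp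
    show "scaled_triples k R (d mod (k * w)) (f mod (k * w)) = scaled_triples k R d f" for d f
    proof (cases "k dvd d \<and> k dvd f")
      case True
      then obtain d' f' where "d = k * d'" "f = k * f'" by (auto simp: dvd_def)
      then show ?thesis using \<open>k > 0\<close> by (simp add: R.periodic)
    next
      case False
      then have "\<not> scaled_triples k R d f" by (auto simp: scaled_triples_def)
      moreover have "\<not> scaled_triples k R (d mod (k * w)) (f mod (k * w))"
        using False iff[of d] iff[of f] by (auto simp: scaled_triples_def)
      ultimately show ?thesis by simp
    qed
    fix d f assume "scaled_triples k R d f"
    then obtain d' f' where eq: "d = k * d'" "f = k * f'" and R: "R d' f'"
      by (auto simp: scaled_triples_def)
    show "scaled_triples k R f d" using R.swap[OF R] \<open>k > 0\<close> by (simp add: eq)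
    have "scaled_triples k R (k * - d') (k * (f' - d'))"
      using R.rebase[OF R] \<open>k > 0\<close> by (simp only: scaled_triples_mult)
    then show "scaled_triples k R (- d) (f - d)" by (simp add: eq right_diff_distrib)
    show "d mod (k * w) \<noteq> 0" using R.nonzero[OF R] \<open>k > 0\<close> by (simp add: eq)
    show "d mod (k * w) \<noteq> f mod (k * w)" using R.distinct[OF R] \<open>k > 0\<close> by (simp add: eq)
  qed
qed

text \<open>A copy of \<open>R\<close> on the subgroup of order \<open>w\<close> of $\mathbb{Z}_{kw}$ for the differences inside it, and
arithmetic progressions for the other differences.\<close>
definition lift_triples :: "int \<Rightarrow> int \<Rightarrow> (int \<Rightarrow> int \<Rightarrow> bool) \<Rightarrow> int \<Rightarrow> int \<Rightarrow> bool" where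
  "lift_triples k w R d f \<longleftrightarrow>
     scaled_triples k R d f \<or> ap_triples (k * w) {x. k dvd x} d f"

lemma lift_triples_multiple:
  assumes "odd k" "lift_triples k w R (k * d) f"
  shows "scaled_triples k R (k * d) f"
proof -
  have "\<not> ap_triples (k * w) {x. k dvd x} (k * d) f"
  proof
    assume ap: "ap_triples (k * w) {x. k dvd x} (k * d) f"
    then have f: "\<not> k dvd f" and "k * w dvd k * d - 2 * f"
      by (auto simp: ap_triples_def cong_iff_dvd_diff)
    then have "k dvd k * d - 2 * f" using dvd_mult_left by blast
    then have "k dvd 2 * f" using dvd_diff[of k "k * d" "k * d - 2 * f"] by simp
    with \<open>odd k\<close> f show False by (simp add: coprime_dvd_mult_right_iff)
  qed
  then show ?thesis using assms(2) by (simp add: lift_triples_def)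
qed

text \<open>Divisibility of \<open>w\<close> by 3 puts the elements of order 3 into the subgroup, so that the differences
outside it, which are covered by progressions, have three distinct third points.\<close>
lemma lift_kernel:
  assumes "cyclic_kernel w R" and k: "k > 0" "odd k" and w: "odd w" "3 dvd w"
  shows "cyclic_kernel (k * w) (lift_triples k w R)"
proof -
  interpret R: cyclic_kernel w R by fact
  have pos: "k * w > 0" using k R.pos by simp
  have "cyclic_triples (k * w) (ap_triples (k * w) {x. k dvd x})"
    by (rule cyclic_ap_triples) (use pos k w in \<open>auto simp: dvd_mod_iff\<close>)
  from cyclic_triples_union[OF cyclic_scaled_triples[OF R.cyclic_triples_axioms k(1)] this]
  interpret cyclic_triples "k * w" "lift_triples k w R"
    unfolding lift_triples_def[abs_def] .
  show ?thesis
  proof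
    fix d assume d: "d mod (k * w) \<noteq> 0"
    show "card {f \<in> {0..<k * w}. lift_triples k w R d f} = 3"
    proof (cases "k dvd d")
      case True
      then obtain d' where d': "d = k * d'" by blast
      have R_iff: "lift_triples k w R (k * d') f \<longleftrightarrow> scaled_triples k R (k * d') f" for f
        using lift_triples_multiple[OF k(2)] by (auto simp: lift_triples_def)
      have "{f \<in> {0..<k * w}. lift_triples k w R d f} = (\<lambda>f. k * f) ` {f \<in> {0..<w}. R d' f}"
        unfolding d' R_iff using k(1) by (auto simp: scaled_triples_def zero_le_mult_iff)
      moreover have "inj_on (\<lambda>f. k * f) {f \<in> {0..<w}. R d' f}" using k(1) by (simp add: inj_on_def)
      moreover have "d' mod w \<noteq> 0" using d d' by auto
      ultimately show ?thesis using R.three by (simp add: card_image)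
    next
      case False
      have "lift_triples k w R d f \<longleftrightarrow> ap_triples (k * w) {x. k dvd x} d f" for f
        using False by (auto simp: lift_triples_def scaled_triples_def)
      moreover have "card {f \<in> {0..<k * w}. ap_triples (k * w) {x. k dvd x} d f} = 3"
      proof (rule ap_triples_three)
        show "odd (k * w)" using k w by simp
        obtain u where u: "w = 3 * u" using w(2) by blast
        show "\<not> [3 * d = 0] (mod k * w)"
        proof
          assume "[3 * d = 0] (mod k * w)"
          then have "3 * (k * u) dvd 3 * d" by (simp add: u cong_iff_dvd_diff ac_simps)
          then have "k * u dvd d" by simp
          with False show False using dvd_mult_left by blast
        qed
        show "f \<notin> {x. k dvd x}" if "[d = 2 * f] (mod k * w)" for f
        proof
          assume "f \<in> {x. k dvd x}"
          then have "k dvd 2 * f" by simp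
          moreover have "k dvd d - 2 * f"
            using that dvd_mult_left unfolding cong_iff_dvd_diff by blast
          ultimately have "k dvd d" using dvd_add[of k "d - 2 * f" "2 * f"] by simp
          with False show False ..
        qed
      qed (use pos False in simp_all)
      ultimately show ?thesis by simp
    qed
  qed
qed

lemma lift_splitting:
  assumes "splitting (k * w) (lift_triples k w R) C" and "k > 0" "odd k" "w > 0"
  shows "splitting w R (\<lambda>x y z. C (k * x) (k * y) (k * z))"
proof (rule splitting_restrict[OF assms(1,2,4)])
  show "k dvd f" if "lift_triples k w R (k * d) f" for d f
    using lift_triples_multiple[OF \<open>odd k\<close> that] by (auto simp: scaled_triples_def)
  show "R d f" if "lift_triples k w R (k * d) (k * f)" for d f
    using lift_triples_multiple[OF \<open>odd k\<close> that] \<open>k > 0\<close> by simp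
qed

lemma lift_no_splitting:
  assumes "\<And>C. \<not> splitting w R C" "k > 0" "odd k" "w > 0"
  shows "\<not> splitting (k * w) (lift_triples k w R) C"
  using lift_splitting[of k w R C] assms by blast

text \<open>The translates of the base triples \<open>{0, a, b}\<close> with \<open>(a, b)\<close> in the list \<open>T\<close>; the six disjuncts are the
six orders of the points.\<close>
definition base_triples :: "int \<Rightarrow> (int \<times> int) list \<Rightarrow> int \<Rightarrow> int \<Rightarrow> bool" where
  "base_triples v T d f \<longleftrightarrow> (\<exists>(a, b) \<in> set T.
     [d = a] (mod v) \<and> [f = b] (mod v) \<or> [d = b] (mod v) \<and> [f = a] (mod v) \<or>
     [d = - a] (mod v) \<and> [f = b - a] (mod v) \<or> [d = b - a] (mod v) \<and> [f = - a] (mod v) \<or>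
     [d = - b] (mod v) \<and> [f = a - b] (mod v) \<or> [d = a - b] (mod v) \<and> [f = - b] (mod v))"

lemma cyclic_base_triples:
  assumes "v > 0"
    and T: "\<And>a b. (a, b) \<in> set T \<Longrightarrow> \<not> [a = 0] (mod v) \<and> \<not> [b = 0] (mod v) \<and> \<not> [a = b] (mod v)"
  shows "cyclic_triples v (base_triples v T)"
proof
  show "base_triples v T (d mod v) (f mod v) = base_triples v T d f" for d f
    by (simp add: base_triples_def cong_def)
  show "base_triples v T f d" if "base_triples v T d f" for d f
    using that unfolding base_triples_def by blast
  show "base_triples v T (- d) (f - d)" if "base_triples v T d f" for d f
  proof -
    have diff: "[- d = - x] (mod v) \<and> [f - d = y - x] (mod v)" if "[d = x] (mod v) \<and> [f = y] (mod v)" for x y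
      using that by (simp add: cong_diff cong_minus_minus_iff)
    from \<open>base_triples v T d f\<close> obtain a b where ab: "(a, b) \<in> set T" and
      "[d = a] (mod v) \<and> [f = b] (mod v) \<or> [d = b] (mod v) \<and> [f = a] (mod v) \<or>
       [d = - a] (mod v) \<and> [f = b - a] (mod v) \<or> [d = b - a] (mod v) \<and> [f = - a] (mod v) \<or>
       [d = - b] (mod v) \<and> [f = a - b] (mod v) \<or> [d = a - b] (mod v) \<and> [f = - b] (mod v)"
      unfolding base_triples_def by blast
    then show ?thesis
      unfolding base_triples_def
      by (intro bexI[OF _ ab], simp only: prod.case) (elim disjE; drule diff; simp)
  qed
  have ne: "d mod v \<noteq> 0 \<and> d mod v \<noteq> f mod v" if "base_triples v T d f" for d f
  proof -
    have incong: "d mod v \<noteq> 0 \<and> d mod v \<noteq> f mod v"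
      if "[d = x] (mod v) \<and> [f = y] (mod v)" "\<not> v dvd x" "\<not> v dvd x - y" for x y
    proof -
      have "x mod v \<noteq> 0" using that(2) by auto
      moreover have "x mod v \<noteq> y mod v" using that(3) mod_eq_dvd_iff by blast
      ultimately show ?thesis using that(1) by (simp add: cong_def)
    qed
    from \<open>base_triples v T d f\<close> obtain a b where ab: "(a, b) \<in> set T" and
      "[d = a] (mod v) \<and> [f = b] (mod v) \<or> [d = b] (mod v) \<and> [f = a] (mod v) \<or>
       [d = - a] (mod v) \<and> [f = b - a] (mod v) \<or> [d = b - a] (mod v) \<and> [f = - a] (mod v) \<or>
       [d = - b] (mod v) \<and> [f = a - b] (mod v) \<or> [d = a - b] (mod v) \<and> [f = - b] (mod v)"
      unfolding base_triples_def by blast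
    moreover have "\<not> v dvd a" "\<not> v dvd b" "\<not> v dvd a - b" "\<not> v dvd b - a"
      using T[OF ab] cong_sym_eq[of a b v] by (simp_all add: cong_iff_dvd_diff)
    ultimately show ?thesis by - (elim disjE; drule incong; simp)
  qed
  show "d mod v \<noteq> 0" "d mod v \<noteq> f mod v" if "base_triples v T d f" for d f
    using ne[OF that] by simp_all
qed fact

section \<open>Orders divisible by 3 but not by 9\<close>

lemma (in cyclic_triples) card_thirds_minus:
  "card {f \<in> {0..<v}. R (- d) f} = card {f \<in> {0..<v}. R d f}"
proof -
  have "R (- d) f \<longleftrightarrow> R d (f + d)" for f
    using rebase[of d "f + d"] rebase[of "- d" f] by auto
  moreover have "R d (f mod v) \<longleftrightarrow> R d f" for f
    by (rule cong) (simp_all add: cong_def)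
  ultimately show ?thesis
    using card_shift_residues[OF pos, of "R d" d] by simp
qed

text \<open>For \<open>u\<close> coprime to 3 the residue of \<open>crt u a b\<close> modulo \<open>3 * u\<close> depends on \<open>a\<close> modulo \<open>u\<close> and on \<open>b\<close>
modulo 3 only, so that \<open>(a, b)\<close> are coordinates for $\mathbb{Z}_{3u} \cong \mathbb{Z}_u \times
\mathbb{Z}_3$.\<close>
definition crt :: "int \<Rightarrow> int \<Rightarrow> int \<Rightarrow> int" where
  "crt u a b = 3 * a + u * b"

lemma crt_arith:
  "- crt u a b = crt u (- a) (- b)"
  "crt u a b - crt u a' b' = crt u (a - a') (b - b')"
  "2 * crt u a b = crt u (2 * a) (2 * b)"
  by (simp_all add: crt_def algebra_simps)

text \<open>With \<open>m = crt u 0 1\<close> of order 3 and \<open>s = crt u 1 1\<close> these are the steps \<open>\<plusminus> m\<close>, \<open>\<plusminus> s\<close> and \<open>\<plusminus> (s + m)\<close>.\<close>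
definition switched_steps :: "int \<Rightarrow> int set" where
  "switched_steps u = {x. \<exists>a \<in> {-1, 0, 1}. \<exists>b \<in> {1, 2}. [x = crt u a b] (mod 3 * u)}"

text \<open>For \<open>v = 3 * u\<close> the progression of step \<open>m\<close> has a short orbit, hence would be a repeated block. Together
with the progressions of steps \<open>s\<close> and \<open>s + m\<close> it covers the differences \<open>m, m, m, s, s, 2 * s\<close>,
\<open>s + m, s + m, 2 * (s + m)\<close> up to sign. The orbits of \<open>{0, m, s + m}\<close>, \<open>{0, s, s + m}\<close> and
\<open>{0, m, 2 * s}\<close> cover the same differences, because \<open>2 * s - m\<close> and \<open>2 * (s + m)\<close> agree.\<close>
definition switched_triples :: "int \<Rightarrow> int \<Rightarrow> int \<Rightarrow> bool" where
  "switched_triples u d f \<longleftrightarrow>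
     base_triples (3 * u) [(crt u 0 1, crt u 1 2), (crt u 1 1, crt u 1 2), (crt u 0 1, crt u 2 2)] d f \<or>
     ap_triples (3 * u) (switched_steps u) d f"

context
  fixes u :: int
  assumes u: "u \<ge> 5" "odd u" "\<not> 3 dvd u"
begin

lemma u_coprime: "coprime 3 u" "coprime u 3" "coprime u 2"
  using prime_imp_coprime[of 3 u] u by (simp_all add: coprime_commute)

lemma crt_cong_zero: "[crt u a b = 0] (mod 3 * u) \<longleftrightarrow> u dvd a \<and> 3 dvd b"
proof -
  have "[crt u a b = 0] (mod 3 * u) \<longleftrightarrow> 3 dvd crt u a b \<and> u dvd crt u a b"
    using divides_mult[OF _ _ u_coprime(1)] by (auto simp: cong_iff_dvd_diff dest: dvd_mult_left dvd_mult_right)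
  also have "3 dvd crt u a b \<longleftrightarrow> 3 dvd b"
    using u_coprime by (simp add: crt_def dvd_add_right_iff coprime_dvd_mult_right_iff)
  also have "u dvd crt u a b \<longleftrightarrow> u dvd a"
    using u_coprime by (simp add: crt_def dvd_add_left_iff coprime_dvd_mult_right_iff)
  finally show ?thesis by blast
qed

lemma crt_cong: "[crt u a b = crt u a' b'] (mod 3 * u) \<longleftrightarrow> u dvd a - a' \<and> 3 dvd b - b'"
  using crt_cong_zero[of "a - a'" "b - b'"] by (simp add: cong_iff_dvd_diff crt_arith)

lemma u_not_dvd: "\<not> u dvd 1" "\<not> u dvd 2" "\<not> u dvd 3" "\<not> u dvd 4" "\<not> u dvd 6"
proof -
  show 1: "\<not> u dvd 1" using u by auto
  show 2: "\<not> u dvd 2" "\<not> u dvd 3" "\<not> u dvd 4" using u(1) zdvd_imp_le by fastforce+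
  have "u dvd 2 * 3 \<longleftrightarrow> u dvd 3" using u_coprime(3) by (rule coprime_dvd_mult_right_iff)
  with 2 show "\<not> u dvd 6" by simp
qed

lemma switched_steps_cong:
  assumes "[x = y] (mod 3 * u)"
  shows "x \<in> switched_steps u \<longleftrightarrow> y \<in> switched_steps u"
  using assms unfolding switched_steps_def by (simp add: cong_def)

lemma crt_mem_switched_steps:
  "crt u a b \<in> switched_steps u \<longleftrightarrow> (u dvd a + 1 \<or> u dvd a \<or> u dvd a - 1) \<and> \<not> 3 dvd b"
proof -
  have "\<not> 3 dvd b \<longleftrightarrow> 3 dvd b - 1 \<or> 3 dvd b - 2" by presburger
  then show ?thesis by (auto simp: switched_steps_def crt_cong)
qed

lemma switched_steps_minus: "- x \<in> switched_steps u \<longleftrightarrow> x \<in> switched_steps u"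
proof -
  have "- x \<in> switched_steps u" if "x \<in> switched_steps u" for x
  proof -
    from that obtain a b where ab: "a \<in> {-1, 0, 1}" "b \<in> {1, 2}" "[x = crt u a b] (mod 3 * u)"
      by (auto simp: switched_steps_def)
    then have "[- x = crt u (- a) (- b)] (mod 3 * u)"
      unfolding crt_arith(1)[symmetric] by (simp only: cong_minus_minus_iff)
    then show ?thesis using ab(1,2) by (auto simp: switched_steps_cong crt_mem_switched_steps)
  qed
  from this[of x] this[of "- x"] show ?thesis by auto
qed

lemma cyclic_switched_triples: "cyclic_triples (3 * u) (switched_triples u)"
  unfolding switched_triples_def[abs_def]
proof (rule cyclic_triples_union)
  show "cyclic_triples (3 * u) (ap_triples (3 * u) (switched_steps u))"
    by (rule cyclic_ap_triples)
      (use u in \<open>auto simp: switched_steps_minus cong_def intro!: switched_steps_cong\<close>)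
  show "cyclic_triples (3 * u)
     (base_triples (3 * u) [(crt u 0 1, crt u 1 2), (crt u 1 1, crt u 1 2), (crt u 0 1, crt u 2 2)])"
    by (rule cyclic_base_triples) (use u u_not_dvd in \<open>auto simp: crt_cong crt_cong_zero\<close>)
qed

lemma crt_double_iff: "[crt u (2 * a) (2 * b) = 2 * f] (mod 3 * u) \<longleftrightarrow> [f = crt u a b] (mod 3 * u)"
  using cong_double_iff[of "3 * u" "crt u a b" f] u by (simp add: crt_arith cong_sym_eq)

text \<open>The third points for the differences that the switch affects. In coordinates these are the
differences \<open>(a, b)\<close> with \<open>\<bar>a\<bar> \<le> 2\<close> and \<open>b\<close> nonzero modulo 3, and up to sign \<open>b = 1\<close>.\<close>
lemma switched_thirds_0:
  "card {f \<in> {0..<3 * u}. switched_triples u (crt u 0 1) f} = 3"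
proof (rule card_three_residues)
  fix f
  have "[crt u 0 1 = 2 * f] (mod 3 * u) \<longleftrightarrow> [f = crt u 0 2] (mod 3 * u)"
    using crt_double_iff[of 0 2 f] crt_cong[of 0 4 0 1] by (simp add: cong_def)
  then have "\<not> ap_triples (3 * u) (switched_steps u) (crt u 0 1) f"
    using switched_steps_cong[of f "crt u 0 2"] by (auto simp: ap_triples_def crt_mem_switched_steps)
  then show "switched_triples u (crt u 0 1) f \<longleftrightarrow> [f = crt u 1 2] (mod 3 * u) \<or>
      [f = crt u (- 1) (- 1)] (mod 3 * u) \<or> [f = crt u 2 2] (mod 3 * u)"
    using u_not_dvd by (simp add: switched_triples_def base_triples_def crt_arith crt_cong)
qed (use u u_not_dvd in \<open>simp_all add: crt_cong\<close>)

lemma switched_thirds_2: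
  "card {f \<in> {0..<3 * u}. switched_triples u (crt u 2 1) f} = 3"
proof (rule card_three_residues)
  fix f
  have "[crt u 2 1 = 2 * f] (mod 3 * u) \<longleftrightarrow> [f = crt u 1 2] (mod 3 * u)"
    using crt_double_iff[of 1 2 f] crt_cong[of 2 4 2 1] by (simp add: cong_def)
  then have "ap_triples (3 * u) (switched_steps u) (crt u 2 1) f \<longleftrightarrow>
      [f = crt u 4 2] (mod 3 * u) \<or> [f = crt u (- 2) (- 1)] (mod 3 * u)"
    using switched_steps_cong[of f "crt u 1 2"] u_not_dvd
    by (auto simp: ap_triples_def crt_mem_switched_steps crt_cong_zero crt_arith)
  then show "switched_triples u (crt u 2 1) f \<longleftrightarrow> [f = crt u 4 2] (mod 3 * u) \<or>
      [f = crt u (- 2) (- 1)] (mod 3 * u) \<or> [f = crt u 0 (- 1)] (mod 3 * u)"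
    using u_not_dvd by (auto simp: switched_triples_def base_triples_def crt_arith crt_cong)
qed (use u u_not_dvd in \<open>simp_all add: crt_cong\<close>)

lemma switched_thirds_minus_2:
  "card {f \<in> {0..<3 * u}. switched_triples u (crt u (- 2) 1) f} = 3"
proof (rule card_three_residues)
  fix f
  have "[crt u (- 2) 1 = 2 * f] (mod 3 * u) \<longleftrightarrow> [f = crt u (- 1) 2] (mod 3 * u)"
    using crt_double_iff[of "- 1" 2 f] crt_cong[of "- 2" 4 "- 2" 1] by (simp add: cong_def)
  then have "ap_triples (3 * u) (switched_steps u) (crt u (- 2) 1) f \<longleftrightarrow>
      [f = crt u (- 4) 2] (mod 3 * u) \<or> [f = crt u 2 (- 1)] (mod 3 * u)"
    using switched_steps_cong[of f "crt u (- 1) 2"] u_not_dvd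
    by (auto simp: ap_triples_def crt_mem_switched_steps crt_cong_zero crt_arith)
  then show "switched_triples u (crt u (- 2) 1) f \<longleftrightarrow> [f = crt u (- 4) 2] (mod 3 * u) \<or>
      [f = crt u 2 (- 1)] (mod 3 * u) \<or> [f = crt u (- 2) (- 1)] (mod 3 * u)"
    using u_not_dvd by (auto simp: switched_triples_def base_triples_def crt_arith crt_cong)
qed (use u u_not_dvd in \<open>simp_all add: crt_cong\<close>)

text \<open>For \<open>d = crt u 1 1\<close> and \<open>d = crt u (- 1) 1\<close> the progressions of step \<open>d\<close> are absent, and the
progression whose step is half of \<open>d\<close> is present.\<close>
lemma switched_half:
  assumes "a = 1 \<or> a = -1"
  obtains h where "\<And>f. ap_triples (3 * u) (switched_steps u) (crt u a 1) f \<longleftrightarrow> [f = h] (mod 3 * u)"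
    and "\<And>b c. [h = crt u b c] (mod 3 * u) \<Longrightarrow> u dvd 2 * b - a"
proof -
  obtain h where h: "\<And>f. [crt u a 1 = 2 * f] (mod 3 * u) \<longleftrightarrow> [f = h] (mod 3 * u)"
    using cong_half[of "3 * u" "crt u a 1"] u by auto
  have half: "u dvd 2 * b - a" if "[h = crt u b c] (mod 3 * u)" for b c
  proof -
    have "[crt u a 1 = 2 * crt u b c] (mod 3 * u)" using h[of "crt u b c"] that by (simp add: cong_sym_eq)
    then have "u dvd a - 2 * b" by (simp add: crt_arith crt_cong)
    then show ?thesis by (simp add: dvd_diff_commute)
  qed
  have "h \<notin> switched_steps u"
  proof
    assume "h \<in> switched_steps u"
    then obtain b c where "b \<in> {-1, 0, 1}" "[h = crt u b c] (mod 3 * u)"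
      by (auto simp: switched_steps_def)
    moreover from this(2) have "u dvd 2 * b - a" by (rule half)
    ultimately show False using assms u_not_dvd by auto
  qed
  then have "ap_triples (3 * u) (switched_steps u) (crt u a 1) f \<longleftrightarrow> [f = h] (mod 3 * u)" for f
    using assms u_not_dvd h[of f] switched_steps_cong[of f h]
    by (auto simp: ap_triples_def crt_mem_switched_steps crt_cong_zero)
  then show thesis using half by (rule that)
qed

lemma switched_thirds_1:
  "card {f \<in> {0..<3 * u}. switched_triples u (crt u 1 1) f} = 3"
proof -
  obtain h where h: "\<And>f. ap_triples (3 * u) (switched_steps u) (crt u 1 1) f \<longleftrightarrow> [f = h] (mod 3 * u)"
    and ne: "\<And>b c. [h = crt u b c] (mod 3 * u) \<Longrightarrow> u dvd 2 * b - 1"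
    using switched_half[of 1] by blast
  show ?thesis
  proof (rule card_three_residues)
    show "switched_triples u (crt u 1 1) f \<longleftrightarrow> [f = h] (mod 3 * u) \<or>
        [f = crt u 0 (- 1)] (mod 3 * u) \<or> [f = crt u 1 2] (mod 3 * u)" for f
      using u_not_dvd by (auto simp: switched_triples_def h base_triples_def crt_arith crt_cong)
    show "\<not> [h = crt u 0 (- 1)] (mod 3 * u)" "\<not> [h = crt u 1 2] (mod 3 * u)"
      using ne u_not_dvd by fastforce+
  qed (use u u_not_dvd in \<open>simp_all add: crt_cong\<close>)
qed

lemma switched_thirds_minus_1:
  "card {f \<in> {0..<3 * u}. switched_triples u (crt u (- 1) 1) f} = 3"
proof -
  obtain h where h: "\<And>f. ap_triples (3 * u) (switched_steps u) (crt u (- 1) 1) f \<longleftrightarrow> [f = h] (mod 3 * u)"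
    and ne: "\<And>b c. [h = crt u b c] (mod 3 * u) \<Longrightarrow> u dvd 2 * b - (- 1)"
    using switched_half[of "- 1"] by blast
  show ?thesis
  proof (rule card_three_residues)
    show "switched_triples u (crt u (- 1) 1) f \<longleftrightarrow> [f = h] (mod 3 * u) \<or>
        [f = crt u 0 (- 1)] (mod 3 * u) \<or> [f = crt u (- 1) (- 1)] (mod 3 * u)" for f
      using u_not_dvd by (auto simp: switched_triples_def h base_triples_def crt_arith crt_cong)
    show "\<not> [h = crt u 0 (- 1)] (mod 3 * u)" "\<not> [h = crt u (- 1) (- 1)] (mod 3 * u)"
      using ne u_not_dvd by fastforce+
  qed (use u u_not_dvd in \<open>simp_all add: crt_cong\<close>)
qed

lemma switched_thirds_generic:
  assumes d: "\<not> [d = 0] (mod 3 * u)"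
    and ne: "\<And>a b. a \<in> {-2..2} \<Longrightarrow> \<not> 3 dvd b \<Longrightarrow> \<not> [d = crt u a b] (mod 3 * u)"
  shows "card {f \<in> {0..<3 * u}. switched_triples u d f} = 3"
proof -
  have "\<not> base_triples (3 * u) [(crt u 0 1, crt u 1 2), (crt u 1 1, crt u 1 2), (crt u 0 1, crt u 2 2)] d f" for f
    using ne by (simp add: base_triples_def crt_arith)
  moreover have "card {f \<in> {0..<3 * u}. ap_triples (3 * u) (switched_steps u) d f} = 3"
  proof (rule ap_triples_three)
    show "\<not> [3 * d = 0] (mod 3 * u)"
    proof
      assume "[3 * d = 0] (mod 3 * u)"
      then have "u dvd d" by (simp add: cong_iff_dvd_diff)
      then obtain b where b: "d = crt u 0 b" by (auto simp: crt_def)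
      show False using d ne[of 0 b] by (cases "3 dvd b") (auto simp: b crt_cong_zero)
    qed
    show "d \<notin> switched_steps u" using ne by (auto simp: switched_steps_def)
    show "f \<notin> switched_steps u" if "[d = 2 * f] (mod 3 * u)" for f
    proof
      assume "f \<in> switched_steps u"
      then obtain a b where ab: "a \<in> {-1, 0, 1}" "b \<in> {1, 2}" "[f = crt u a b] (mod 3 * u)"
        by (auto simp: switched_steps_def)
      then have "[d = crt u (2 * a) (2 * b)] (mod 3 * u)"
        unfolding crt_arith(3)[symmetric] using that cong_scalar_left cong_trans by blast
      then show False using ne[of "2 * a" "2 * b"] ab(1,2) by auto
    qed
  qed (use u in simp_all)
  ultimately show ?thesis by (simp add: switched_triples_def)
qed

lemma switched_kernel: "cyclic_kernel (3 * u) (switched_triples u)"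
proof -
  interpret cyclic_triples "3 * u" "switched_triples u" by (rule cyclic_switched_triples)
  show ?thesis
  proof
    fix d assume "d mod (3 * u) \<noteq> 0"
    then have d: "\<not> [d = 0] (mod 3 * u)" by (simp add: cong_def)
    have one: "card {f \<in> {0..<3 * u}. switched_triples u x f} = 3"
      if a: "a \<in> {-2..2}" and x: "[x = crt u a b] (mod 3 * u)" and b: "3 dvd b - 1" for x a b
    proof -
      have "[x = crt u a 1] (mod 3 * u)" using x crt_cong[of a b a 1] b by (simp add: cong_def)
      then have "switched_triples u x f \<longleftrightarrow> switched_triples u (crt u a 1) f" for f
        by (rule cong) simp
      moreover have "a = -2 \<or> a = -1 \<or> a = 0 \<or> a = 1 \<or> a = 2" using a by auto
      then have "card {f \<in> {0..<3 * u}. switched_triples u (crt u a 1) f} = 3"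
        using switched_thirds_minus_2 switched_thirds_minus_1 switched_thirds_0 switched_thirds_1
          switched_thirds_2 by blast
      ultimately show ?thesis by simp
    qed
    show "card {f \<in> {0..<3 * u}. switched_triples u d f} = 3"
    proof (cases "\<exists>a b. a \<in> {-2..2} \<and> \<not> 3 dvd b \<and> [d = crt u a b] (mod 3 * u)")
      case True
      then obtain a b where ab: "a \<in> {-2..2}" "\<not> 3 dvd b" "[d = crt u a b] (mod 3 * u)" by blast
      have "3 dvd b - 1 \<or> 3 dvd - b - 1" using ab(2) by presburger
      then consider "3 dvd b - 1" | "3 dvd - b - 1" by blast
      then show ?thesis
      proof cases
        case 1
        with ab one show ?thesis by blast
      next
        case 2
        have "[- d = crt u (- a) (- b)] (mod 3 * u)"
          unfolding crt_arith(1)[symmetric] using ab(3) by (simp only: cong_minus_minus_iff)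
        moreover have "- a \<in> {-2..2}" using ab(1) by auto
        ultimately have "card {f \<in> {0..<3 * u}. switched_triples u (- d) f} = 3" using one 2 by blast
        then show ?thesis by (simp only: card_thirds_minus)
      qed
    next
      case False
      then show ?thesis using switched_thirds_generic[OF d] by blast
    qed
  qed
qed

text \<open>The three new base triples meet each residue class modulo 3 in exactly one point. Hence inside a class
only arithmetic progressions occur.\<close>
lemma switched_multiple_of_3:
  assumes "switched_triples u (3 * d) f"
  shows "3 dvd f" "f = 3 * f' \<Longrightarrow> ap_triples u {} d f'"
proof -
  have d: "3 * d = crt u d 0" by (simp add: crt_def)
  have "\<not> base_triples (3 * u) [(crt u 0 1, crt u 1 2), (crt u 1 1, crt u 1 2), (crt u 0 1, crt u 2 2)] (crt u d 0) f"
    by (simp add: base_triples_def crt_arith crt_cong)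
  then have ap: "ap_triples (3 * u) (switched_steps u) (3 * d) f"
    using assms by (simp add: switched_triples_def d)
  then consider "3 * u dvd f - 2 * (3 * d)" | "3 * u dvd f + 3 * d" | "3 * u dvd 3 * d - 2 * f"
    by (auto simp: ap_triples_def cong_iff_dvd_diff)
  then show "3 dvd f" by cases (drule dvd_mult_left, presburger)+
  assume f: "f = 3 * f'"
  have dvd: "3 * u dvd 3 * x \<longleftrightarrow> u dvd x" for x by simp
  have "[x = y] (mod u)" if "[3 * x = 3 * y] (mod 3 * u)" for x y
    using that dvd[of "x - y"] by (simp add: cong_iff_dvd_diff right_diff_distrib)
  from this[of f' "2 * d"] this[of f' "- d"] this[of d "2 * f'"] dvd[of d] ap
  show "ap_triples u {} d f'" unfolding f by (auto simp: ap_triples_def cong_iff_dvd_diff[of _ 0])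
qed

lemma switched_no_splitting:
  assumes "splitting (3 * u) (switched_triples u) C"
  shows False
proof (rule ap_no_splitting)
  show "splitting u (ap_triples u {}) (\<lambda>x y z. C (3 * x) (3 * y) (3 * z))"
    by (rule splitting_restrict[OF assms])
      (use u switched_multiple_of_3 in auto)
qed (use u in simp_all)

end

section \<open>A system of order 27\<close>

text \<open>A base triple for each of the 13 orbits of a cyclic system on 27 points, found by a computer search
for a system with a short proof of indecomposability.\<close>
definition bases27 :: "(int \<times> int) list" where
  "bases27 = [(7, 8), (10, 11), (1, 13), (2, 6), (4, 6), (7, 9), (3, 10), (3, 11), (3, 12),
     (11, 15), (5, 10), (9, 14), (8, 14)]"

text \<open>For each nonzero difference modulo 27 the three third points.\<close>
definition thirds27 :: "(int \<times> int \<times> int \<times> int) list" where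
  "thirds27 =
    [(1, 13, 17, 20), (2, 6, 20, 23), (3, 10, 11, 12), (4, 6, 16, 25),
     (5, 10, 18, 22), (6, 2, 4, 19), (7, 8, 9, 24), (8, 7, 14, 24),
     (9, 7, 14, 24), (10, 3, 5, 11), (11, 3, 10, 15), (12, 3, 23, 26),
     (13, 1, 21, 22), (14, 8, 9, 15), (15, 11, 14, 18), (16, 4, 19, 26),
     (17, 1, 20, 22), (18, 5, 15, 25), (19, 6, 16, 26), (20, 1, 2, 17),
     (21, 13, 23, 25), (22, 5, 13, 17), (23, 2, 12, 21), (24, 7, 8, 9),
     (25, 4, 18, 21), (26, 12, 16, 19)]"

lemma base_triples27_iff:
  assumes "(d, a, b, c) \<in> set thirds27"
  shows "base_triples 27 bases27 d f \<longleftrightarrow> f mod 27 = a \<or> f mod 27 = b \<or> f mod 27 = c"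
  using assms unfolding thirds27_def list.set
  by (simp only: insert_iff empty_iff prod.inject simp_thms, elim disjE conjE)
    (simp_all add: base_triples_def bases27_def cong_def, (blast | argo)+)

lemma kernel27: "cyclic_kernel 27 (base_triples 27 bases27)"
proof -
  interpret cyclic_triples 27 "base_triples 27 bases27"
    by (rule cyclic_base_triples) (auto simp: bases27_def cong_def)
  show ?thesis
  proof
    fix d :: int assume d: "d mod 27 \<noteq> 0"
    have "0 \<le> d mod 27 \<and> d mod 27 < 27" by simp
    with d have "d mod 27 \<in> fst ` set thirds27" by (simp add: thirds27_def) presburger
    then obtain a b c where t: "(d mod 27, a, b, c) \<in> set thirds27" by auto
    then have abc: "a \<in> {0..<27} \<and> b \<in> {0..<27} \<and> c \<in> {0..<27} \<and> a \<noteq> b \<and> a \<noteq> c \<and> b \<noteq> c"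
      unfolding thirds27_def list.set
      by (simp only: insert_iff empty_iff prod.inject simp_thms, elim disjE conjE) simp_all
    show "card {f \<in> {0..<27}. base_triples 27 bases27 d f} = 3"
    proof (rule card_three_residues)
      fix f
      have "base_triples 27 bases27 d f \<longleftrightarrow> base_triples 27 bases27 (d mod 27) f"
        by (rule cong) (simp_all add: cong_def)
      also note base_triples27_iff[OF t]
      finally show "base_triples 27 bases27 d f \<longleftrightarrow> [f = a] (mod 27) \<or> [f = b] (mod 27) \<or> [f = c] (mod 27)"
        using abc by (simp add: cong_def)
    qed (use abc in \<open>simp_all add: cong_def\<close>)
  qed
qed

text \<open>The orbits of \<open>{0, 3, 10}\<close> and of \<open>{0, 10, 11}\<close> are excluded one after the other, and this forces all
translates of \<open>{0, 5, 10}\<close>, two of which share a pair.\<close>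
lemma no_splitting27:
  assumes "splitting 27 (base_triples 27 bases27) C"
  shows False
proof -
  interpret splitting 27 "base_triples 27 bases27" C by fact
  have pick: "C x y (x + a) \<or> C x y (x + b) \<or> C x y (x + c)"
    if t: "(d, a, b, c) \<in> set thirds27" and y: "y = x + d" and d: "\<not> 27 dvd d" for x y d a b c
  proof -
    have "\<not> [x = y] (mod 27)" using d by (simp add: y cong_iff_dvd_diff)
    then obtain z where z: "C x y z" "base_triples 27 bases27 (y - x) (z - x)" by (rule third_exists)
    then have "(z - x) mod 27 = a \<or> (z - x) mod 27 = b \<or> (z - x) mod 27 = c"
      using base_triples27_iff[OF t] by (simp add: y)
    moreover have "[z = x + (z - x) mod 27] (mod 27)" by (simp add: cong_def mod_simps)
    then have "C x y (x + (z - x) mod 27)" using z(1) cong[OF cong_refl cong_refl] by blast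
    ultimately show ?thesis by auto
  qed
  have wrap: "C x y (z + 24) \<longleftrightarrow> C x y (z - 3)" for x y z
    by (rule cong) (simp_all add: cong_iff_dvd_diff)
  have p3: "C x (x + 3) (x + 10) \<or> C x (x + 3) (x + 11) \<or> C x (x + 3) (x + 12)" for x
    by (rule pick[of 3]) (simp_all add: thirds27_def)
  have p7: "C x (x + 7) (x + 8) \<or> C x (x + 7) (x + 9) \<or> C x (x + 7) (x - 3)" for x
    unfolding wrap[symmetric] by (rule pick[of 7]) (simp_all add: thirds27_def)
  have p8: "C x (x + 8) (x + 7) \<or> C x (x + 8) (x + 14) \<or> C x (x + 8) (x - 3)" for x
    unfolding wrap[symmetric] by (rule pick[of 8]) (simp_all add: thirds27_def)
  have p9: "C x (x + 9) (x + 7) \<or> C x (x + 9) (x + 14) \<or> C x (x + 9) (x - 3)" for x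
    unfolding wrap[symmetric] by (rule pick[of 9]) (simp_all add: thirds27_def)
  have p10: "C x (x + 10) (x + 3) \<or> C x (x + 10) (x + 5) \<or> C x (x + 10) (x + 11)" for x
    by (rule pick[of 10]) (simp_all add: thirds27_def)
  have unique: False if "C x y z" "C x y z'" "\<not> 27 dvd x - y" "\<not> 27 dvd z - z'" for x y z z'
    using third_unique[of x y z z'] that by (simp add: cong_iff_dvd_diff)
  have perm: "C x z y" "C y x z" "C y z x" "C z x y" "C z y x" if "C x y z" for x y z
    using rotate[OF that] rotate[OF rotate[OF that]] swap[OF that] swap[OF rotate[OF that]]
      swap[OF rotate[OF rotate[OF that]]] by simp_all
  have no10: "\<not> C x (x + 3) (x + 10)" for x
  proof
    assume *: "C x (x + 3) (x + 10)"
    \<comment> \<open>The pairs \<open>{3, 11}\<close> and \<open>{3, 12}\<close>, shifted by \<open>x\<close>, both need the third point 17.\<close>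
    have "\<not> C (x + 3) (x + 11) (x + 10)"
      using unique[of "x + 3" "x + 10" x "x + 11"] perm(3)[OF *] perm(1) by auto
    moreover have "\<not> C (x + 3) (x + 11) x"
      using unique[of x "x + 3" "x + 10" "x + 11"] * perm(4) by auto
    ultimately have "C (x + 3) (x + 11) (x + 17)" using p8[of "x + 3"] by (simp add: add.commute)
    moreover
    have "\<not> C (x + 3) (x + 12) (x + 10)"
      using unique[of "x + 3" "x + 10" x "x + 12"] perm(3)[OF *] perm(1) by auto
    moreover have "\<not> C (x + 3) (x + 12) x"
      using unique[of x "x + 3" "x + 10" "x + 12"] * perm(4) by auto
    ultimately have "C (x + 3) (x + 11) (x + 17)" "C (x + 3) (x + 12) (x + 17)"
      using p9[of "x + 3"] by (simp_all add: add.commute)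
    then show False using unique[of "x + 3" "x + 17" "x + 11" "x + 12"] perm(1) by auto
  qed
  have no11: "\<not> C x (x + 10) (x + 11)" for x
  proof
    assume *: "C x (x + 10) (x + 11)"
    \<comment> \<open>The pairs \<open>{0, 3}\<close> and \<open>{3, 10}\<close>, shifted by \<open>x\<close>, both need the third point 12.\<close>
    have "\<not> C x (x + 3) (x + 11)"
      using unique[of x "x + 11" "x + 10" "x + 3"] perm(1)[OF *] perm(1) by auto
    then have "C x (x + 3) (x + 12)" using p3[of x] no10 by blast
    moreover have "\<not> C (x + 3) (x + 10) (x + 11)"
      using unique[of "x + 10" "x + 11" x "x + 3"] perm(3)[OF *] perm(3) by auto
    moreover have "\<not> C (x + 3) (x + 10) x" using no10 perm(4) by blast
    ultimately have **: "C x (x + 3) (x + 12)" "C (x + 3) (x + 10) (x + 12)"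
      using p7[of "x + 3"] by (simp_all add: add.commute)
    show False using unique[OF perm(3)[OF **(1)] perm(1)[OF **(2)]] by simp
  qed
  have five: "C x (x + 10) (x + 5)" for x
    using p10[of x] no10[of x] no11[of x] perm(1) by blast
  show False using unique[of 5 10 0 15] perm(5)[OF five[of 0]] perm(1)[OF five[of 5]] by simp
qed

section \<open>Existence for all admissible orders\<close>

lemma unsplittable_kernel_exists:
  fixes v :: int
  assumes v: "v \<ge> 5" "odd v" "v \<noteq> 9"
  shows "\<exists>R. cyclic_kernel v R \<and> (\<forall>C. \<not> splitting v R C)"
proof (cases "3 dvd v")
  case False
  have "cyclic_kernel v (ap_triples v {})" by (rule ap_kernel) (use v False in simp_all)
  moreover have "\<not> splitting v (ap_triples v {}) C" for C
  proof
    assume "splitting v (ap_triples v {}) C"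
    then show False by (rule ap_no_splitting) (use v False in simp_all)
  qed
  ultimately show ?thesis by blast
next
  case True
  then obtain t where t: "v = 3 * t" by (rule dvdE)
  show ?thesis
  proof (cases "3 dvd t")
    case False
    have "t \<ge> 2" "odd t" "t \<noteq> 3" using v t False by auto
    moreover from this have "t \<noteq> 2" "t \<noteq> 4" by auto
    ultimately have t': "t \<ge> 5" "odd t" "\<not> 3 dvd t" using False by linarith+
    show ?thesis unfolding t
      using switched_kernel[OF t'] switched_no_splitting[OF t'] by blast
  next
    case True
    then obtain u where u: "t = 3 * u" by (rule dvdE)
    show ?thesis
    proof (cases "3 dvd u")
      case False
      have "u \<ge> 1" "odd u" "u \<noteq> 1" "u \<noteq> 3" using v t u False by auto
      moreover from this have "u \<noteq> 2" "u \<noteq> 4" by auto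
      ultimately have u': "u \<ge> 5" "odd u" "\<not> 3 dvd u" using False by linarith+
      have "cyclic_kernel (3 * (3 * u)) (lift_triples 3 (3 * u) (switched_triples u))"
        by (rule lift_kernel[OF switched_kernel[OF u']]) (use u' in simp_all)
      moreover have "\<not> splitting (3 * (3 * u)) (lift_triples 3 (3 * u) (switched_triples u)) C" for C
        by (rule lift_no_splitting) (use u' switched_no_splitting[OF u'] in \<open>simp_all, blast\<close>)
      ultimately show ?thesis unfolding t u by blast
    next
      case True
      then obtain k where "u = 3 * k" by (rule dvdE)
      then have vk: "v = k * 27" using t u by simp
      then have k: "k > 0" "odd k" using v by auto
      have "cyclic_kernel (k * 27) (lift_triples k 27 (base_triples 27 bases27))"
        by (rule lift_kernel[OF kernel27]) (use k in simp_all)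
      moreover have "\<not> splitting (k * 27) (lift_triples k 27 (base_triples 27 bases27)) C" for C
        by (rule lift_no_splitting) (use k no_splitting27 in \<open>simp_all, blast\<close>)
      ultimately show ?thesis unfolding vk by blast
    qed
  qed
qed

theorem theorem5p1:
  fixes v :: nat
  assumes "v \<ge> 5"
    and "odd v"
    and "v \<noteq> 9"
    and "\<And>c::nat. c \<ge> 2 \<Longrightarrow> v \<noteq> 24 * c + 57"
  shows "\<exists>(V :: nat set) B. triple_system 3 v V B \<and> cyclic_system V B \<and>
           simple_system B \<and> indecomposable_system 3 v V B"
proof -
  have "int v \<ge> 5" "odd (int v)" "int v \<noteq> 9" using assms(1-3) by simp_all
  from unsplittable_kernel_exists[OF this]
  obtain R where R: "cyclic_kernel (int v) R" "\<And>C. \<not> splitting (int v) R C" by blast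
  show ?thesis by (rule indecomposable_system_of_kernel[OF R])
qed

end
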